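(* There is a function $b\colon\mathbb{N}\to(0,\infty)$ such that the following holds. Let $U\subseteq\mathbb{R}^d$ be open and let $f\colon\overline{U}\to\mathbb{R}^d$ be a Lipschitz regular mapping. Then there exist pairwise disjoint, open sets $(A_n)_{n=1}^\infty$ contained in $\overline{U}$ such that $\bigcup_{n=1}^\infty A_n$ is dense in $\overline{U}$ and, for each $n\in\mathbb{N}$, $f|_{A_n}$ is bilipschitz with lower bilipschitz constant $b(\operatorname{Reg}(f))$, i.e. $\|f(x)-f(y)\|_2\geq b(\operatorname{Reg}(f))\|x-y\|_2$ for all $x,y\in A_n$.
   Context: Lipschitz regular: a Lipschitz mapping $f\colon M\to M'$ between metric spaces is called Lipschitz regular if there is a constant $C\in\mathbb{N}$ such that for every $r>0$ and every (open) ball $B\subset M'$ of radius $r$, the set $f^{-1}(B)$ can be covered by at most $C$ balls of radius $Cr$ in $M$. The smallest such $C$ is denoted by $\operatorname{Reg}(f)$. Euclidean metrics are used here. A mapping $h$ is bilipschitz with lower bilipschitz constant $b>0$ if it is Lipschitz and $\|h(x)-h(y)\|_2\ge b\|x-y\|_2$ for all $x,y$ in its domain. *)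

theory Defs
  imports "HOL-Analysis.Analysis"
begin

section \<open>Lipschitz regular and bilipschitz mappings\<close>

text \<open>
  A mapping between metric spaces is a total function whose values outside the carrier
  \<open>mspace m1\<close> of the domain are irrelevant. The constants \<open>C\<close> are positive natural numbers;
  \<open>C = 0\<close> would only be possible for an empty domain.
\<close>

definition regularity_constant ::
    "'a metric \<Rightarrow> 'b metric \<Rightarrow> ('a \<Rightarrow> 'b) \<Rightarrow> nat \<Rightarrow> bool" where
  "regularity_constant m1 m2 f C \<longleftrightarrow>
     C \<ge> 1 \<and>
     (\<forall>r>0. \<forall>y\<in>mspace m2. \<exists>P. P \<subseteq> mspace m1 \<and> finite P \<and> card P \<le> C \<and>
        {x \<in> mspace m1. f x \<in> mball_of m2 y r} \<subseteq> (\<Union>p\<in>P. mball_of m1 p (real C * r)))"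

definition Lipschitz_regular :: "'a metric \<Rightarrow> 'b metric \<Rightarrow> ('a \<Rightarrow> 'b) \<Rightarrow> bool" where
  "Lipschitz_regular m1 m2 f \<longleftrightarrow>
     Lipschitz_continuous_map m1 m2 f \<and> (\<exists>C. regularity_constant m1 m2 f C)"

definition Reg :: "'a metric \<Rightarrow> 'b metric \<Rightarrow> ('a \<Rightarrow> 'b) \<Rightarrow> nat" where
  "Reg m1 m2 f = (LEAST C. regularity_constant m1 m2 f C)"

definition bilipschitz_with_lower_constant ::
    "'a metric \<Rightarrow> 'b metric \<Rightarrow> real \<Rightarrow> ('a \<Rightarrow> 'b) \<Rightarrow> bool" where
  "bilipschitz_with_lower_constant m1 m2 b f \<longleftrightarrow>
     b > 0 \<and> Lipschitz_continuous_map m1 m2 f \<and>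
     (\<forall>x\<in>mspace m1. \<forall>y\<in>mspace m1. mdist m2 (f x) (f y) \<ge> b * mdist m1 x y)"


section \<open>The Euclidean metric on \<open>d\<close>-dimensional space\<close>

text \<open>
  So that the dimension can be quantified inside a formula, the \<open>d\<close>-dimensional space is the
  carrier of the library's \<^const>\<open>Euclidean_space\<close>: sequences that vanish from index \<open>d\<close> on.
\<close>

definition Euclidean_dist :: "nat \<Rightarrow> (nat \<Rightarrow> real) \<Rightarrow> (nat \<Rightarrow> real) \<Rightarrow> real" where
  "Euclidean_dist d x y = L2_set (\<lambda>i. x i - y i) {..<d}"

definition Euclidean_metric :: "nat \<Rightarrow> (nat \<Rightarrow> real) metric" where
  "Euclidean_metric d = metric (topspace (Euclidean_space d), Euclidean_dist d)"

lemma Metric_space_Euclidean: "Metric_space (topspace (Euclidean_space d)) (Euclidean_dist d)"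
proof
  fix x y z :: "nat \<Rightarrow> real"
  show "0 \<le> Euclidean_dist d x y"
    by (simp add: Euclidean_dist_def)
  show "Euclidean_dist d x y = Euclidean_dist d y x"
    by (simp add: Euclidean_dist_def L2_set_def power2_commute)
  show "Euclidean_dist d x y = 0 \<longleftrightarrow> x = y"
    if "x \<in> topspace (Euclidean_space d)" "y \<in> topspace (Euclidean_space d)"
  proof -
    have "x = y \<longleftrightarrow> (\<forall>i<d. x i = y i)"
      using that unfolding topspace_Euclidean_space fun_eq_iff mem_Collect_eq
      by (metis not_le_imp_less)
    then show ?thesis
      by (auto simp: Euclidean_dist_def L2_set_eq_0_iff)
  qed
  show "Euclidean_dist d x z \<le> Euclidean_dist d x y + Euclidean_dist d y z"
    using L2_set_triangle_ineq [of "\<lambda>i. x i - y i" "\<lambda>i. y i - z i" "{..<d}"]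
    by (simp add: Euclidean_dist_def)
qed

lemma mspace_Euclidean_metric [simp]:
  "mspace (Euclidean_metric d) = topspace (Euclidean_space d)"
  by (simp add: Euclidean_metric_def Metric_space_Euclidean Metric_space.mspace_metric)

lemma mdist_Euclidean_metric [simp]: "mdist (Euclidean_metric d) = Euclidean_dist d"
  by (simp add: Euclidean_metric_def Metric_space_Euclidean Metric_space.mdist_metric)

lemma mtopology_of_Euclidean_metric: "mtopology_of (Euclidean_metric d) = Euclidean_space d"
proof -
  interpret E: Metric_space "topspace (Euclidean_space d)" "Euclidean_dist d"
    by (rule Metric_space_Euclidean)
  have mt: "mtopology_of (Euclidean_metric d) = E.mtopology"
    by (simp add: mtopology_of_def)
  have top: "Euclidean_space d = top_of_set (topspace (Euclidean_space d))"
    by (metis Euclidean_space_def euclidean_product_topology topspace_Euclidean_space)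
  have ball: "openin (Euclidean_space d) (E.mball x r)" if x: "x \<in> topspace (Euclidean_space d)" for x r
  proof -
    have "continuous_on UNIV (\<lambda>y. Euclidean_dist d x y)"
      unfolding Euclidean_dist_def L2_set_def
      by (intro continuous_intros continuous_on_product_coordinates)
    then have "open {y. Euclidean_dist d x y < r}"
      by (intro open_Collect_less continuous_on_const)
    moreover have "E.mball x r = topspace (Euclidean_space d) \<inter> {y. Euclidean_dist d x y < r}"
      using x by (auto simp: E.in_mball)
    ultimately show ?thesis
      by (metis top openin_open)
  qed
  have coord: "continuous_map E.mtopology euclideanreal (\<lambda>x. x i)" for i
  proof (cases "i < d")
    case True
    have "Lipschitz_continuous_map (Euclidean_metric d) euclidean_metric (\<lambda>x. x i)"
      unfolding Lipschitz_continuous_map_def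
    proof (intro conjI exI ballI)
      fix x y :: "nat \<Rightarrow> real"
      have "\<bar>x i - y i\<bar> \<le> L2_set (\<lambda>i. \<bar>x i - y i\<bar>) {..<d}"
        using True by (intro member_le_L2_set) auto
      then show "mdist euclidean_metric (x i) (y i) \<le> 1 * mdist (Euclidean_metric d) x y"
        by (simp add: dist_real_def Euclidean_dist_def L2_set_def)
    qed simp
    then show ?thesis
      using Lipschitz_continuous_imp_continuous_map mt by fastforce
  next
    case False
    have "0 = x i" if "x \<in> topspace E.mtopology" for x
    proof -
      have "x \<in> topspace (Euclidean_space d)"
        using that by (simp only: E.topspace_mtopology)
      then show ?thesis
        using False by (auto simp: topspace_Euclidean_space)
    qed
    moreover have "continuous_map E.mtopology euclideanreal (\<lambda>x. 0)"
      by simp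
    ultimately show ?thesis
      by (rule continuous_map_eq[rotated])
  qed
  have "continuous_map E.mtopology (powertop_real UNIV) (\<lambda>x. x)"
    unfolding continuous_map_componentwise_UNIV using coord by blast
  moreover have "topspace E.mtopology \<subseteq> {x. \<forall>i\<ge>d. x i = 0}"
    by (metis E.topspace_mtopology topspace_Euclidean_space subset_refl)
  ultimately have "continuous_map E.mtopology (Euclidean_space d) (\<lambda>x. x)"
    by (subst Euclidean_space_def) (auto simp: continuous_map_in_subtopology)
  then have 1: "openin E.mtopology S" if "openin (Euclidean_space d) S" for S
    using that openin_subset[OF that]
    by (fastforce simp: continuous_map_def Collect_conj_eq Int_absorb1 Int_absorb2)
  have 2: "openin (Euclidean_space d) S" if S: "openin E.mtopology S" for S
  proof (subst openin_subopen, intro ballI)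
    fix x assume x: "x \<in> S"
    then obtain r where "r > 0" "E.mball x r \<subseteq> S"
      using S unfolding E.openin_mtopology by blast
    moreover have "x \<in> topspace (Euclidean_space d)"
      using S x unfolding E.openin_mtopology by blast
    ultimately show "\<exists>T. openin (Euclidean_space d) T \<and> x \<in> T \<and> T \<subseteq> S"
      using ball E.centre_in_mball_iff by blast
  qed
  show ?thesis
    unfolding mt topology_eq using 1 2 by blast
qed

end

theory Submission
  imports Defs "HOL-Homology.Brouwer_Degree"
begin

text \<open>
  A regular map has a metric rigidity: the preimage of a ball of radius \<open>r\<close> lies in \<open>C\<close> balls of
  radius \<open>C r\<close>, so two points of it at distance more than \<open>2 C\<^sup>2 r\<close> are separated by a spherical
  shell which the preimage does not meet (\<open>regular_on_distance_gap\<close>). Hence a pair \<open>x\<close>, \<open>y\<close> that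
  violates the lower bilipschitz bound splits the preimage of a ball around \<open>f x\<close> into two open parts,
  one around each of the points. The proof shows that on a suitable open set such a splitting is
  impossible.

  Call an open set \<open>E\<close> essential over an open ball \<open>T\<close> if every continuous map on \<open>E\<close> that agrees
  with \<open>f\<close> wherever \<open>f\<close> lies outside \<open>T\<close> still covers \<open>T\<close>. Three facts about this notion suffice, and
  they replace degree theory. Essentiality passes to smaller balls, since the condition on the competing
  maps becomes stronger. If the part of \<open>E\<close> over a neighbourhood of the closure of \<open>T\<close> falls apart into two open pieces and \<open>E\<close>
  is essential over \<open>T\<close>, then so is one of the pieces: otherwise both pieces could be pushed off \<open>T\<close>
  and the results glued (\<open>essential_split\<close>). Finally, every nonempty open set is essential over some ball
  (\<open>exists_essential_ball\<close>).

  Disjoint sets that are essential over one ball contain different points of one fibre, so there are at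
  most \<open>C\<close> of them. Take a family of maximal size, over a ball \<open>T\<close>, and let \<open>E\<close> be one of its
  members. If a pair in \<open>E\<close> violates the lower bound, then \<open>E\<close> splits over a small ball \<open>T'\<close> around
  \<open>f x\<close>; one part is essential over \<open>T'\<close>, and the preimage of \<open>T'\<close> in the other part is a nonempty
  open set, hence essential over a still smaller ball. Replacing \<open>E\<close> by these two sets enlarges the
  family, a contradiction (\<open>exists_lower_bilipschitz_piece\<close>).

  That nonempty open sets are essential somewhere rests on an approximate differentiability statement.
  A real Lipschitz function is almost affine on some ball whose size is bounded below in terms of the
  error only: across a range of scales at which the maximal slope hardly changes, a pair of points which
  nearly attains that slope forces the function to be almost linear near the midpoint. Because the scale
  is controlled, this can be done for all coordinates of \<open>f\<close> at once. The linear part cannot contract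
  any direction strongly, for \<open>f\<close> would map a segment into a ball whose preimage has a gap
  (\<open>near_nonsingular_linear\<close>). A map close to a nonsingular linear one covers a ball stably, because a
  continuous vector field on a ball that points outwards on the boundary has a zero; this is where the
  noncontractibility of spheres enters.

  All of this yields a piece inside any given nonempty open set; a countable base of the topology then
  supplies the required disjoint family.

  The dimension is a variable of the statement. To have norms, inner products and continuity from type
  classes in all dimensions simultaneously, \<open>d\<close>-dimensional space is realized as the subspace
  of the inner product space of finitely supported sequences that is spanned by the first \<open>d\<close> unit
  sequences.
\<close>

section \<open>Finitely supported sequences\<close>


typedef finseq = "{x :: nat \<Rightarrow> real. finite {i. x i \<noteq> 0}}"
  morphisms coord Finseq
  by (rule exI[of _ "\<lambda>_. 0"]) simp

setup_lifting type_definition_finseq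

lemma finite_support_coord: "finite {i. coord x i \<noteq> 0}"
  using coord by blast

lemma finseq_eqI: "(\<And>i. coord x i = coord y i) \<Longrightarrow> x = y"
  by (simp add: coord_inject[symmetric] fun_eq_iff)

instantiation finseq :: real_vector
begin

lift_definition zero_finseq :: finseq is "\<lambda>_. 0" by simp

lift_definition plus_finseq :: "finseq \<Rightarrow> finseq \<Rightarrow> finseq" is "\<lambda>x y i. x i + y i"
  subgoal for x y
    by (rule finite_subset[of _ "{i. x i \<noteq> 0} \<union> {i. y i \<noteq> 0}"]) auto
  done

lift_definition uminus_finseq :: "finseq \<Rightarrow> finseq" is "\<lambda>x i. - x i" by simp

lift_definition minus_finseq :: "finseq \<Rightarrow> finseq \<Rightarrow> finseq" is "\<lambda>x y i. x i - y i"
  subgoal for x y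
    by (rule finite_subset[of _ "{i. x i \<noteq> 0} \<union> {i. y i \<noteq> 0}"]) auto
  done

lift_definition scaleR_finseq :: "real \<Rightarrow> finseq \<Rightarrow> finseq" is "\<lambda>c x i. c * x i"
  subgoal for c x by (rule finite_subset[of _ "{i. x i \<noteq> 0}"]) auto
  done

instance
  by standard (transfer; simp add: algebra_simps)+

end

instantiation finseq :: real_inner
begin

definition inner_finseq :: "finseq \<Rightarrow> finseq \<Rightarrow> real" where
  "inner_finseq x y = (\<Sum>i | coord x i \<noteq> 0. coord x i * coord y i)"

definition norm_finseq :: "finseq \<Rightarrow> real" where
  "norm_finseq x = sqrt (inner x x)"

definition sgn_finseq :: "finseq \<Rightarrow> finseq" where
  "sgn_finseq x = x /\<^sub>R norm x"

definition dist_finseq :: "finseq \<Rightarrow> finseq \<Rightarrow> real" where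
  "dist_finseq x y = norm (x - y)"

definition uniformity_finseq :: "(finseq \<times> finseq) filter" where
  "uniformity_finseq = (INF e\<in>{0<..}. principal {(x, y). dist x y < e})"

definition open_finseq :: "finseq set \<Rightarrow> bool" where
  "open_finseq U \<longleftrightarrow> (\<forall>x\<in>U. \<forall>\<^sub>F (x', y) in uniformity. x' = x \<longrightarrow> y \<in> U)"

lemma inner_finseq_superset:
  assumes "finite A" "{i. coord x i \<noteq> 0} \<subseteq> A"
  shows "inner x y = (\<Sum>i\<in>A. coord x i * coord y i)"
  unfolding inner_finseq_def using assms by (intro sum.mono_neutral_left) auto

instance
proof
  fix x y z :: finseq and r :: real
  define A where "A = {i. coord x i \<noteq> 0} \<union> {i. coord y i \<noteq> 0} \<union> {i. coord z i \<noteq> 0}"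
  have A: "finite A" by (simp add: A_def finite_support_coord)
  have sub: "{i. coord x i \<noteq> 0} \<subseteq> A" "{i. coord y i \<noteq> 0} \<subseteq> A"
    "{i. coord (x + y) i \<noteq> 0} \<subseteq> A" "{i. coord (r *\<^sub>R x) i \<noteq> 0} \<subseteq> A"
    by (auto simp: A_def plus_finseq.rep_eq scaleR_finseq.rep_eq)
  note on_A = inner_finseq_superset[OF A]
  show "inner x y = inner y x"
    by (simp add: on_A[OF sub(1)] on_A[OF sub(2)] mult.commute)
  show "inner (x + y) z = inner x z + inner y z"
    by (simp add: on_A[OF sub(1)] on_A[OF sub(2)] on_A[OF sub(3)] plus_finseq.rep_eq
        distrib_right sum.distrib)
  show "inner (r *\<^sub>R x) y = r * inner x y"
    by (simp add: on_A[OF sub(1)] on_A[OF sub(4)] scaleR_finseq.rep_eq sum_distrib_left mult.assoc)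
  show "0 \<le> inner x x"
    by (simp add: inner_finseq_def sum_nonneg)
  show "inner x x = 0 \<longleftrightarrow> x = 0"
    by (auto simp: inner_finseq_def sum_nonneg_eq_0_iff finite_support_coord zero_finseq.rep_eq
        intro!: finseq_eqI)
qed (simp_all add: norm_finseq_def sgn_finseq_def dist_finseq_def uniformity_finseq_def
    open_finseq_def)

end

lift_definition unit_seq :: "nat \<Rightarrow> finseq" is "\<lambda>n i. if i = n then 1 else 0"
  by simp

lemma unit_seq_orthonormal: "inner (unit_seq i) (unit_seq j) = (if i = j then 1 else 0)"
  by (simp add: inner_finseq_superset[of "{i}"] unit_seq.rep_eq)

section \<open>Coordinate subspaces\<close>

definition Rn :: "nat \<Rightarrow> finseq set" where
  "Rn d = {x. \<forall>i\<ge>d. coord x i = 0}"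

lemma subspace_Rn: "subspace (Rn d)"
  by (auto simp: subspace_def Rn_def zero_finseq.rep_eq plus_finseq.rep_eq scaleR_finseq.rep_eq)

lemmas Rn_closed [simp] =
  subspace_0[OF subspace_Rn] subspace_add[OF subspace_Rn] subspace_diff[OF subspace_Rn]
  subspace_scale[OF subspace_Rn] subspace_sum[OF subspace_Rn]

lemma unit_seq_in_Rn [simp]: "unit_seq i \<in> Rn d \<longleftrightarrow> i < d"
  by (auto simp: Rn_def unit_seq.rep_eq)

lemma norm_unit_seq [simp]: "norm (unit_seq i) = 1"
  by (simp add: norm_eq_sqrt_inner unit_seq_orthonormal)

lemma inner_Rn: "x \<in> Rn d \<Longrightarrow> inner x y = (\<Sum>i<d. coord x i * coord y i)"
  by (rule inner_finseq_superset) (auto simp: Rn_def not_le)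

lemma coord_eq_inner: "coord x i = inner (unit_seq i) x"
  by (simp add: inner_finseq_superset[of "{i}"] unit_seq.rep_eq)

lemma continuous_on_coord [continuous_intros]:
  "continuous_on A f \<Longrightarrow> continuous_on A (\<lambda>x. coord (f x) i)"
  unfolding coord_eq_inner by (intro continuous_intros)

lemma coord_sum: "coord (\<Sum>i\<in>A. f i) j = (\<Sum>i\<in>A. coord (f i) j)"
  by (simp add: coord_eq_inner inner_sum_right)

lemma Rn_expansion:
  assumes "x \<in> Rn d" shows "x = (\<Sum>i<d. coord x i *\<^sub>R unit_seq i)"
proof (rule finseq_eqI)
  fix j
  have "coord (\<Sum>i<d. coord x i *\<^sub>R unit_seq i) j = (\<Sum>i<d. if i = j then coord x i else 0)"
    unfolding coord_sum by (intro sum.cong) (auto simp: scaleR_finseq.rep_eq unit_seq.rep_eq)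
  also have "\<dots> = coord x j"
    using assms by (auto simp: Rn_def)
  finally show "coord x j = coord (\<Sum>i<d. coord x i *\<^sub>R unit_seq i) j" by simp
qed

lemma coord_Finseq [simp]:
  assumes "x \<in> topspace (Euclidean_space d)" shows "coord (Finseq x) = x"
proof (rule Finseq_inverse)
  have "{i. x i \<noteq> 0} \<subseteq> {..<d}"
    using assms by (auto simp: topspace_Euclidean_space not_le[symmetric])
  then show "x \<in> {x. finite {i. x i \<noteq> 0}}"
    using finite_subset by blast
qed

lemma Finseq_in_Rn: "x \<in> topspace (Euclidean_space d) \<Longrightarrow> Finseq x \<in> Rn d"
  by (auto simp: Rn_def) (simp add: topspace_Euclidean_space)

lemma coord_in_Euclidean_space: "x \<in> Rn d \<Longrightarrow> coord x \<in> topspace (Euclidean_space d)"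
  by (simp add: Rn_def topspace_Euclidean_space)

lemma continuous_on_Finseq: "continuous_on (topspace (Euclidean_space d)) Finseq"
proof (rule continuous_on_eq)
  show "continuous_on (topspace (Euclidean_space d)) (\<lambda>x. \<Sum>i<d. x i *\<^sub>R unit_seq i)"
    by (intro continuous_intros continuous_on_subset[OF continuous_on_product_coordinates]) auto
  show "(\<Sum>i<d. x i *\<^sub>R unit_seq i) = Finseq x" if "x \<in> topspace (Euclidean_space d)" for x
    using Rn_expansion[OF Finseq_in_Rn[OF that]] that by simp
qed

lemma continuous_on_coord_fun:
  assumes "continuous_on A f" shows "continuous_on A (\<lambda>x. coord (f x))"
  by (intro continuous_on_coordinatewise_then_product continuous_on_coord assms)

lemma dist_Finseq:
  assumes "x \<in> topspace (Euclidean_space d)" "y \<in> topspace (Euclidean_space d)"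
  shows "dist (Finseq x) (Finseq y) = Euclidean_dist d x y"
proof -
  have "Finseq x - Finseq y \<in> Rn d"
    using assms by (simp add: Finseq_in_Rn)
  then show ?thesis
    using assms
    by (simp add: dist_norm norm_eq_sqrt_inner inner_Rn minus_finseq.rep_eq Euclidean_dist_def
        L2_set_def power2_eq_square)
qed

lemma topspace_nsphere_norm:
  "topspace (nsphere n) = {x \<in> topspace (Euclidean_space (Suc n)). norm (Finseq x) = 1}"
proof -
  have "(\<Sum>i\<le>n. (x i)\<^sup>2) = 1 \<longleftrightarrow> norm (Finseq x) = 1"
    if "x \<in> topspace (Euclidean_space (Suc n))" for x
    using Finseq_in_Rn[OF that] that
    by (simp add: norm_eq_sqrt_inner inner_Rn power2_eq_square lessThan_Suc_atMost)
  then show ?thesis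
    by (auto simp: nsphere_def)
qed

section \<open>Vector fields that point outwards\<close>

text \<open>
  Turns a deformation through nowhere vanishing vectors into a homotopy of self-maps of the sphere.
\<close>

lemma homotopic_nsphere_normalized:
  fixes G :: "real \<times> finseq \<Rightarrow> finseq"
  assumes cont: "continuous_on ({0..1} \<times> {x \<in> Rn (Suc n). norm x = 1}) G"
    and G: "\<And>t x. \<lbrakk>t \<in> {0..1}; x \<in> Rn (Suc n); norm x = 1\<rbrakk> \<Longrightarrow> G (t, x) \<in> Rn (Suc n) - {0}"
  shows "homotopic_with (\<lambda>_. True) (nsphere n) (nsphere n)
    (\<lambda>x. coord (sgn (G (0, Finseq x)))) (\<lambda>x. coord (sgn (G (1, Finseq x))))"
proof -
  define Z where "Z = topspace (nsphere n)"
  have nsphere_Z: "nsphere n = top_of_set Z"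
    unfolding Z_def nsphere by (simp add: euclidean_product_topology)
  have Z: "Z = {x \<in> topspace (Euclidean_space (Suc n)). norm (Finseq x) = 1}"
    by (simp add: Z_def topspace_nsphere_norm)
  define h where "h = (\<lambda>p. coord (sgn (G (fst p, Finseq (snd p)))))"
  have sphere: "Finseq x \<in> {x \<in> Rn (Suc n). norm x = 1}" if "x \<in> Z" for x
    using that Finseq_in_Rn by (auto simp: Z)
  have "continuous_on ({0..1} \<times> Z) (\<lambda>p. Finseq (snd p))"
    by (rule continuous_on_compose2[OF continuous_on_Finseq continuous_on_snd])
      (auto intro: continuous_intros simp: Z)
  then have "continuous_on ({0..1} \<times> Z) (\<lambda>p. (fst p, Finseq (snd p)))"
    by (intro continuous_intros)
  then have "continuous_on ({0..1} \<times> Z) (\<lambda>p. G (fst p, Finseq (snd p)))"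
    by (rule continuous_on_compose2[OF cont]) (use sphere in auto)
  then have "continuous_on ({0..1} \<times> Z) h"
    unfolding h_def using G sphere
    by (intro continuous_on_coord_fun continuous_on_sgn) fastforce+
  moreover have "h ` ({0..1} \<times> Z) \<subseteq> Z"
  proof clarify
    fix t :: real and x assume tx: "t \<in> {0..1}" "x \<in> Z"
    have "G (t, Finseq x) \<in> Rn (Suc n) - {0}"
      using G tx sphere by blast
    then have "sgn (G (t, Finseq x)) \<in> Rn (Suc n)" "norm (sgn (G (t, Finseq x))) = 1"
      by (auto simp: sgn_div_norm norm_sgn)
    then show "h (t, x) \<in> Z"
      by (simp add: h_def Z coord_in_Euclidean_space coord_inverse)
  qed
  ultimately have "continuous_map (prod_topology (top_of_set {0..1}) (nsphere n)) (nsphere n) h"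
    by (auto simp: nsphere_Z prod_topology_subtopology_eu)
  then show ?thesis
    unfolding homotopic_with_def by (intro exI[of _ h]) (simp add: h_def)
qed

text \<open>
  If there were no zero, the normalized map could be shrunk along radii to a constant,
  while the segment from \<open>k x\<close> to the outer normal avoids the origin; composing the two deformations
  would contract the sphere.
\<close>

lemma outward_map_has_zero:
  assumes m: "m \<in> Rn d" and "\<rho> > 0"
    and cont: "continuous_on (cball m \<rho> \<inter> Rn d) k"
    and k: "k ` (cball m \<rho> \<inter> Rn d) \<subseteq> Rn d"
    and outward: "\<And>x. \<lbrakk>x \<in> Rn d; dist m x = \<rho>\<rbrakk> \<Longrightarrow> inner (k x) (x - m) > 0"
  shows "\<exists>x\<in>cball m \<rho> \<inter> Rn d. k x = 0"
proof (rule ccontr)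
  assume "\<not> ?thesis"
  then have nz: "k x \<in> Rn d - {0}" if "x \<in> cball m \<rho> \<inter> Rn d" for x
    using that k by blast
  show False
  proof (cases d)
    case 0
    have "Rn 0 = {0}"
      by (auto simp: Rn_def zero_finseq.rep_eq intro: finseq_eqI)
    then show False
      using nz[of m] m \<open>\<rho> > 0\<close> 0 by auto
  next
    case (Suc n)
    let ?X = "{x \<in> Rn (Suc n). norm x = 1}"
    have in_ball: "m + (t * \<rho>) *\<^sub>R x \<in> cball m \<rho> \<inter> Rn d" if "t \<in> {0..1}" "x \<in> ?X" for t x
      using that m \<open>\<rho> > 0\<close> Suc by (auto simp: dist_norm abs_mult mult_le_cancel_right1)
    have cont_k: "continuous_on ({0..1} \<times> ?X) (\<lambda>p. k (m + (\<tau> p * \<rho>) *\<^sub>R snd p))"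
      if "continuous_on ({0..1} \<times> ?X) \<tau>" "\<And>p. p \<in> {0..1} \<times> ?X \<Longrightarrow> \<tau> p \<in> {0..1}" for \<tau>
      by (rule continuous_on_compose2[OF cont])
        (use in_ball that in \<open>auto intro!: continuous_intros\<close>)
    \<comment> \<open>\<open>G1\<close> contracts the boundary values of \<open>k\<close> to the vector at the centre, and \<open>G2\<close> moves them
      to the outer normal.\<close>
    define G1 where "G1 = (\<lambda>p. k (m + (fst p * \<rho>) *\<^sub>R snd p))"
    define G2 where "G2 = (\<lambda>p. (1 - fst p) *\<^sub>R k (m + (1 * \<rho>) *\<^sub>R snd p) + fst p *\<^sub>R snd p)"
    have "homotopic_with (\<lambda>_. True) (nsphere n) (nsphere n)
        (\<lambda>x. coord (sgn (G1 (0, Finseq x)))) (\<lambda>x. coord (sgn (G1 (1, Finseq x))))"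
    proof (rule homotopic_nsphere_normalized)
      show "continuous_on ({0..1} \<times> ?X) G1"
        unfolding G1_def by (rule cont_k) (auto intro!: continuous_intros)
      show "G1 (t, x) \<in> Rn (Suc n) - {0}" if "t \<in> {0..1}" "x \<in> Rn (Suc n)" "norm x = 1" for t x
        using nz[OF in_ball] that Suc by (auto simp: G1_def)
    qed
    moreover have "homotopic_with (\<lambda>_. True) (nsphere n) (nsphere n)
        (\<lambda>x. coord (sgn (G2 (0, Finseq x)))) (\<lambda>x. coord (sgn (G2 (1, Finseq x))))"
    proof (rule homotopic_nsphere_normalized)
      show "continuous_on ({0..1} \<times> ?X) G2"
        unfolding G2_def by (intro continuous_intros cont_k) auto
      show "G2 (t, x) \<in> Rn (Suc n) - {0}" if t: "t \<in> {0..1}" and x: "x \<in> Rn (Suc n)" "norm x = 1"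
        for t x
      proof -
        have "inner (k (m + \<rho> *\<^sub>R x)) x > 0"
          using outward[of "m + \<rho> *\<^sub>R x"] x m \<open>\<rho> > 0\<close> Suc
          by (simp add: dist_norm zero_less_mult_iff)
        moreover have "inner x x = 1"
          using x by (simp add: norm_eq_1)
        ultimately have "inner (G2 (t, x)) x > 0"
          using t by (cases "t = 1") (auto simp: G2_def inner_add_left intro: add_pos_nonneg)
        moreover have "k (m + \<rho> *\<^sub>R x) \<in> Rn (Suc n)"
          using nz[OF in_ball[of 1 x]] x Suc by simp
        then have "G2 (t, x) \<in> Rn (Suc n)"
          using x by (simp add: G2_def)
        ultimately show ?thesis by auto
      qed
    qed
    moreover have "G1 (1, x) = G2 (0, x)" for x
      by (simp add: G1_def G2_def)
    ultimately have "homotopic_with (\<lambda>_. True) (nsphere n) (nsphere n)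
        (\<lambda>x. coord (sgn (G1 (0, Finseq x)))) (\<lambda>x. coord (sgn (G2 (1, Finseq x))))"
      using homotopic_with_trans by fastforce
    then have "homotopic_with (\<lambda>_. True) (nsphere n) (nsphere n) id (\<lambda>x. coord (sgn (k m)))"
      unfolding homotopic_with_sym[of _ _ _ id]
      by (rule homotopic_with_eq)
        (auto simp: G1_def G2_def topspace_nsphere_norm sgn_div_norm)
    then show False
      using non_contractible_space_nsphere contractible_space_def by blast
  qed
qed

section \<open>Gaps in a set covered by few balls\<close>

text \<open>
  Each ball contributes distances from \<open>x\<close> in an interval of length \<open>2 R\<close> only, and \<open>C\<close> such intervals
  cannot cover an interval of length \<open>D\<close>.
\<close>

lemma distance_gap_of_ball_cover:
  fixes x :: "'a::metric_space"
  assumes P: "finite P" "card P \<le> C" and cover: "S \<subseteq> (\<Union>p\<in>P. ball p R)"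
    and "R > 0" and D: "D > 2 * real C * R"
  obtains t where "0 < t" "t < D" "\<And>z. z \<in> S \<Longrightarrow> dist x z \<noteq> t"
proof -
  have "\<exists>t\<in>{0<..<D}. \<forall>z\<in>S. dist x z \<noteq> t"
  proof (rule ccontr)
    assume "\<not> ?thesis"
    then have hit: "\<exists>z\<in>S. dist x z = t" if "t \<in> {0<..<D}" for t
      using that by blast
    define I where "I p = {dist x p - R..dist x p + R}" for p
    have "D > 0"
      using D \<open>R > 0\<close> by (smt (verit) mult_nonneg_nonneg of_nat_0_le_iff)
    have "{0<..<D} \<subseteq> (\<Union>p\<in>P. I p)"
    proof
      fix t assume "t \<in> {0<..<D}"
      then obtain z where z: "z \<in> S" "dist x z = t" using hit by blast
      then obtain p where p: "p \<in> P" "dist p z < R" using cover by auto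
      have "\<bar>dist x z - dist x p\<bar> \<le> dist p z"
        using dist_triangle[of x z p] dist_triangle[of x p z] by (simp add: dist_commute abs_le_iff)
      then show "t \<in> (\<Union>p\<in>P. I p)"
        using z p by (force simp: I_def)
    qed
    then have "measure lborel {0<..<D} \<le> measure lborel (\<Union>p\<in>P. I p)"
      by (intro measure_mono_fmeasurable fmeasurable.finite_UN P) (auto simp: I_def fmeasurable_cbox[of "_::real", unfolded cbox_interval])
    also have "\<dots> \<le> (\<Sum>p\<in>P. measure lborel (I p))"
      by (intro measure_UNION_le P) (simp add: I_def)
    also have "\<dots> = card P * (2 * R)"
      using \<open>R > 0\<close> by (simp add: I_def)
    also have "\<dots> \<le> C * (2 * R)"
      using P \<open>R > 0\<close> by (intro mult_right_mono) auto
    finally show False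
      using D \<open>D > 0\<close> by simp
  qed
  then show ?thesis using that by auto
qed

section \<open>Lipschitz functions are almost affine on large subballs\<close>

text \<open>
  When a segment is divided into equal parts, the slope over the whole segment is the average of the
  slopes over the parts, so some part does at least as well.
\<close>

lemma subsegment_of_large_slope:
  fixes u :: "'a::real_normed_vector \<Rightarrow> real"
  assumes "s > 0" "dist x y \<ge> s" and slope: "u x - u y \<ge> \<mu> * dist x y"
  obtains x' y' where "x' \<in> closed_segment x y" "y' \<in> closed_segment x y"
    "s \<le> dist x' y'" "dist x' y' \<le> 2 * s" "u x' - u y' \<ge> \<mu> * dist x' y'"
proof -
  define n where "n = nat \<lfloor>dist x y / s\<rfloor>"
  have n: "real n \<le> dist x y / s" "dist x y / s < real n + 1" "n \<ge> 1"
    using assms unfolding n_def by (auto simp: le_nat_iff le_floor_iff)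
  define q where "q i = y + (real i / real n) *\<^sub>R (x - y)" for i
  have q_dist: "dist (q (Suc i)) (q i) = dist x y / n" for i
  proof -
    have "q (Suc i) - q i = (1 / real n) *\<^sub>R (x - y)"
      using n by (simp add: q_def scaleR_left_diff_distrib[symmetric] diff_divide_distrib[symmetric])
    then show ?thesis by (simp add: dist_norm)
  qed
  have q_seg: "q i \<in> closed_segment x y" if "i \<le> n" for i
  proof -
    have "q i = (1 - (1 - real i / n)) *\<^sub>R x + (1 - real i / n) *\<^sub>R y"
      by (simp add: q_def algebra_simps)
    then show ?thesis
      using that n unfolding in_segment by (intro exI[of _ "1 - real i / n"]) auto
  qed
  have "\<exists>i<n. u (q (Suc i)) - u (q i) \<ge> \<mu> * (dist x y / n)"
  proof (rule ccontr)
    assume "\<not> ?thesis"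
    then have "(\<Sum>i<n. u (q (Suc i)) - u (q i)) < (\<Sum>i<n. \<mu> * (dist x y / n))"
      using n(3) by (intro sum_strict_mono) (auto simp: not_le lessThan_empty_iff)
    also have "\<dots> = \<mu> * dist x y"
      using n by simp
    also have "(\<Sum>i<n. u (q (Suc i)) - u (q i)) = u (q n) - u (q 0)"
      by (rule sum_lessThan_telescope)
    also have "\<dots> = u x - u y"
      using n by (simp add: q_def)
    finally show False using slope by simp
  qed
  then obtain i where i: "i < n" "u (q (Suc i)) - u (q i) \<ge> \<mu> * (dist x y / n)" by blast
  have "s \<le> dist x y / n"
    using n \<open>s > 0\<close> by (simp add: field_simps)
  moreover have "dist x y / n \<le> 2 * s"
  proof -
    have "dist x y \<le> (real n + 1) * s"
      using n \<open>s > 0\<close> by (simp add: field_simps)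
    also have "\<dots> \<le> (2 * real n) * s"
      using n \<open>s > 0\<close> by (intro mult_right_mono) auto
    finally show ?thesis
      using n by (simp add: field_simps)
  qed
  ultimately show ?thesis
    using that[of "q (Suc i)" "q i"] i q_seg q_dist by simp
qed

text \<open>
  Second-order expansion of the norm at a vector of length \<open>r\<close>, from \<open>2 r t \<le> r\<^sup>2 + t\<^sup>2\<close>.
\<close>

lemma norm_add_le_inner:
  fixes v w :: "'a::real_inner"
  assumes "norm v = r" "r > 0"
  shows "norm (v + w) \<le> r + inner v w / r + (norm w)\<^sup>2 / (2 * r)"
proof -
  define t where "t = r + inner v w / r + (norm w)\<^sup>2 / (2 * r)"
  have "2 * r * t = r\<^sup>2 + (norm (v + w))\<^sup>2"
    using assms unfolding t_def power2_norm_eq_inner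
    by (simp add: field_simps inner_add_left inner_add_right inner_commute power2_eq_square
        norm_eq_sqrt_inner)
       (metis assms(1) norm_eq_sqrt_inner power2_eq_square power2_norm_eq_inner)
  moreover have "2 * r * norm (v + w) \<le> r\<^sup>2 + (norm (v + w))\<^sup>2"
    by (rule sum_squares_bound[of r, simplified])
  ultimately have "2 * r * norm (v + w) \<le> 2 * r * t" by simp
  then show ?thesis
    using \<open>r > 0\<close> by (simp add: t_def)
qed

definition almost_affine_on ::
    "'a::real_inner set \<Rightarrow> real \<Rightarrow> ('a \<Rightarrow> real) \<Rightarrow> 'a \<Rightarrow> 'a \<Rightarrow> real \<Rightarrow> bool" where
  "almost_affine_on S \<epsilon> u a m \<sigma> \<longleftrightarrow>
     (\<forall>z\<in>cball m \<sigma> \<inter> S. \<bar>u z - u m - inner a (z - m)\<bar> \<le> \<epsilon> * \<sigma>)"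

text \<open>
  The essential point is that \<open>c\<close> depends on neither the ball nor the function. The suprema \<open>M k\<close> of the
  slopes over distances at least \<open>\<eta> ^ k * \<rho>\<close> increase with \<open>k\<close> and are bounded by \<open>L\<close>, so among the
  first \<open>K\<close> steps one is shorter than \<open>\<delta>\<close>. At that scale some pair \<open>x\<close>, \<open>y\<close> nearly attains the slope
  which bounds \<open>u\<close> from above along \<open>z - y\<close> and from below along \<open>z - x\<close>. Near the
  midpoint both distances are affine in \<open>z\<close> up to second order, and the two bounds pinch \<open>u\<close>.
\<close>

lemma Lipschitz_function_almost_affine:
  fixes S :: "'a::real_inner set"
  assumes S: "subspace S" and e: "e \<in> S" "norm e = 1" and "\<epsilon> > 0" "L \<ge> 0"
  shows "\<exists>c>0. \<forall>p\<in>S. \<forall>\<rho>>0. \<forall>u :: 'a \<Rightarrow> real. L-lipschitz_on (cball p \<rho> \<inter> S) u \<longrightarrow>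
    (\<exists>m\<in>S. \<exists>\<sigma>\<ge>c * \<rho>. cball m \<sigma> \<subseteq> cball p \<rho> \<and> (\<exists>a. almost_affine_on S \<epsilon> u a m \<sigma>))"
proof -
  define \<eta> where "\<eta> = min (1/4) (\<epsilon> / (L + 1))"
  have \<eta>: "0 < \<eta>" "\<eta> \<le> 1/4" "L * \<eta> \<le> \<epsilon>"
  proof -
    show "0 < \<eta>" using \<open>\<epsilon> > 0\<close> \<open>L \<ge> 0\<close> by (simp add: \<eta>_def)
    show "\<eta> \<le> 1/4" unfolding \<eta>_def by (rule min.cobounded1)
    have "L * \<eta> \<le> L * (\<epsilon> / (L + 1))"
      using \<open>L \<ge> 0\<close> by (intro mult_left_mono) (auto simp: \<eta>_def)
    also have "\<dots> \<le> \<epsilon>"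
      using \<open>L \<ge> 0\<close> \<open>\<epsilon> > 0\<close> by (simp add: field_simps)
    finally show "L * \<eta> \<le> \<epsilon>" .
  qed
  define \<delta> where "\<delta> = \<eta> * \<epsilon> / 16"
  have \<delta>: "\<delta> > 0" using \<eta> \<open>\<epsilon> > 0\<close> by (simp add: \<delta>_def)
  obtain K where K: "L < real K * \<delta>"
    using reals_Archimedean3[OF \<delta>] by blast
  define c where "c = \<eta> ^ Suc K / 4"
  have "c > 0" using \<eta> by (simp add: c_def)
  moreover have "\<exists>m\<in>S. \<exists>\<sigma>\<ge>c * \<rho>. cball m \<sigma> \<subseteq> cball p \<rho> \<and> (\<exists>a. almost_affine_on S \<epsilon> u a m \<sigma>)"
    if p: "p \<in> S" and \<rho>: "\<rho> > 0" and u: "L-lipschitz_on (cball p \<rho> \<inter> S) u"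
    for p :: 'a and \<rho> :: real and u :: "'a \<Rightarrow> real"
  proof -
    \<comment> \<open>The balls \<open>B k\<close> grow with \<open>k\<close>, which makes \<open>M\<close> monotone and leaves room for a ball of
      radius comparable to \<open>s k\<close> around any point of \<open>B k\<close> inside \<open>B (Suc k)\<close>.\<close>
    define s where "s k = \<eta> ^ k * \<rho>" for k
    define B where "B k = cball p (\<rho> * (1 - \<eta> ^ k / 2)) \<inter> S" for k
    define slopes where "slopes k = {(u x - u y) / dist x y |x y. x \<in> B k \<and> y \<in> B k \<and> dist x y \<ge> s k}" for k
    define M where "M k = Sup (slopes k)" for k
    have s_pos: "s k > 0" for k using \<rho> \<eta> by (simp add: s_def)
    have s_mono: "s j \<le> s i" if "i \<le> j" for i j
      using that \<rho> \<eta> by (simp add: s_def power_decreasing)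
    have B_mono: "B i \<subseteq> B j" if "i \<le> j" for i j
    proof -
      have "\<rho> * (1 - \<eta> ^ i / 2) \<le> \<rho> * (1 - \<eta> ^ j / 2)"
        using power_decreasing[OF that, of \<eta>] \<eta> \<rho> by simp
      then show ?thesis by (auto simp: B_def)
    qed
    have B_sub: "B k \<subseteq> cball p \<rho> \<inter> S" for k
    proof -
      have "\<rho> * (1 - \<eta> ^ k / 2) \<le> \<rho>" using \<eta> \<rho> by (simp add: mult_le_cancel_left1)
      then show ?thesis by (auto simp: B_def)
    qed
    have slope_le_L: "v \<le> L" if v: "v \<in> slopes k" for v k
    proof -
      obtain x y where xy: "v = (u x - u y) / dist x y" "x \<in> B k" "y \<in> B k" "dist x y \<ge> s k"
        using v by (auto simp: slopes_def)
      have "dist (u x) (u y) \<le> L * dist x y"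
        using lipschitz_onD[OF u] xy B_sub by blast
      moreover have "dist x y > 0" using xy s_pos[of k] by linarith
      ultimately show ?thesis
        using xy(1) by (simp add: dist_real_def divide_le_eq)
    qed
    then have bdd: "bdd_above (slopes k)" for k
      by (rule bdd_aboveI)
    have slope_le_M: "u x - u y \<le> M k * dist x y"
      if "x \<in> B k" "y \<in> B k" "dist x y \<ge> s k" for x y k
    proof -
      have "(u x - u y) / dist x y \<le> M k"
        unfolding M_def by (rule cSup_upper[OF _ bdd]) (use that in \<open>auto simp: slopes_def\<close>)
      moreover have "dist x y > 0" using that s_pos[of k] by linarith
      ultimately show ?thesis by (simp add: divide_le_eq)
    qed
    define x0 where "x0 = p + (\<rho>/2) *\<^sub>R e"
    define y0 where "y0 = p - (\<rho>/2) *\<^sub>R e"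
    have x0y0: "x0 \<in> B 0" "y0 \<in> B 0" "dist x0 y0 = s 0"
    proof -
      show "x0 \<in> B 0" "y0 \<in> B 0"
        using S p e \<rho> by (auto simp: x0_def y0_def B_def dist_norm subspace_add subspace_diff subspace_scale)
      have "x0 - y0 = \<rho> *\<^sub>R e"
        by (simp add: x0_def y0_def flip: scaleR_add_left)
      then show "dist x0 y0 = s 0" using \<rho> e by (simp add: dist_norm s_def)
    qed
    have in_Bk: "x0 \<in> B k" "y0 \<in> B k" "dist x0 y0 \<ge> s k" for k
      using x0y0 B_mono[of 0 k] s_mono[of 0 k] by auto
    then have slopes_ne: "slopes k \<noteq> {}" for k
      by (force simp: slopes_def)
    have M_le: "M k \<le> L" for k
      unfolding M_def using slopes_ne slope_le_L by (rule cSup_least)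
    have M_nonneg: "0 \<le> M k" for k
    proof -
      have "u x0 - u y0 \<le> M k * dist x0 y0" "u y0 - u x0 \<le> M k * dist y0 x0"
        using in_Bk[of k] slope_le_M[of x0 k y0] slope_le_M[of y0 k x0] by (simp_all add: dist_commute)
      then have "0 \<le> 2 * (M k * dist x0 y0)" by (simp add: dist_commute)
      then show ?thesis
        using x0y0 s_pos[of 0] by (simp add: zero_le_mult_iff)
    qed
    have "\<exists>k<K. M (Suc k) \<le> M k + \<delta>"
    proof (rule ccontr)
      assume "\<not> ?thesis"
      then have grow: "M (Suc k) > M k + \<delta>" if "k < K" for k
        using that by (auto simp: not_le)
      have "M k \<ge> k * \<delta>" if "k \<le> K" for k
        using that
      proof (induction k)
        case 0
        then show ?case using M_nonneg by simp
      next
        case (Suc k)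
        then show ?case using grow[of k] by (simp add: algebra_simps)
      qed
      from this[of K] show False using K M_le[of K] by simp
    qed
    then obtain k where k: "k < K" "M (Suc k) \<le> M k + \<delta>" by blast
    define \<kappa> where "\<kappa> = M (Suc k)"
    have \<kappa>: "0 \<le> \<kappa>" "\<kappa> \<le> L" "M k - \<delta> \<ge> \<kappa> - 2 * \<delta>"
      using M_nonneg M_le k by (auto simp: \<kappa>_def)
    obtain v where "v \<in> slopes k" "M k - \<delta> < v"
      using less_cSupE[OF _ slopes_ne, of "M k - \<delta>" k] \<delta> by (auto simp: M_def)
    then obtain x1 y1 where 1: "x1 \<in> B k" "y1 \<in> B k" "dist x1 y1 \<ge> s k"
      "(\<kappa> - 2 * \<delta>) < (u x1 - u y1) / dist x1 y1"
      using \<kappa> by (force simp: slopes_def)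
    moreover have "dist x1 y1 > 0"
      using 1 s_pos[of k] by linarith
    ultimately have "u x1 - u y1 \<ge> (\<kappa> - 2 * \<delta>) * dist x1 y1"
      by (simp add: less_divide_eq)
    \<comment> \<open>Shortening the segment keeps the error \<open>\<delta> * dist x y\<close> small compared with \<open>\<sigma>\<close>.\<close>
    then obtain x y where xy: "x \<in> closed_segment x1 y1" "y \<in> closed_segment x1 y1"
        "s k \<le> dist x y" "dist x y \<le> 2 * s k" "u x - u y \<ge> (\<kappa> - 2 * \<delta>) * dist x y"
      using subsegment_of_large_slope[OF s_pos 1(3)] by metis
    have convB: "convex (B k)"
      unfolding B_def by (intro convex_Int convex_cball subspace_imp_convex S)
    have xyB: "x \<in> B k" "y \<in> B k"
      using xy closed_segment_subset[OF 1(1,2) convB] by auto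
    define r where "r = dist x y / 2"
    have r: "r > 0" "s k \<le> 2 * r" "r \<le> s k" using xy s_pos[of k] by (auto simp: r_def)
    define m where "m = midpoint x y"
    have mB: "m \<in> B k"
      unfolding m_def using closed_segment_subset[OF xyB convB] midpoint_in_closed_segment by blast
    define \<sigma> where "\<sigma> = \<eta> * r / 2"
    have \<sigma>: "0 < \<sigma>" "\<sigma> \<le> r / 8" using r \<eta> by (auto simp: \<sigma>_def mult_right_mono[of \<eta> "1/4"])
    define a where "a = (\<kappa> / (2 * r)) *\<^sub>R (x - y)"
    have "m \<in> S" using mB by (simp add: B_def)
    moreover have "c * \<rho> \<le> \<sigma>"
    proof -
      have "c * \<rho> \<le> \<eta> * (\<eta> ^ k * \<rho>) / 4"
        using power_decreasing[of k K \<eta>] k \<eta> \<rho> by (simp add: c_def)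
      also have "\<dots> \<le> \<sigma>"
        using mult_left_mono[OF r(2), of \<eta>] \<eta> by (simp add: \<sigma>_def s_def algebra_simps)
      finally show ?thesis .
    qed
    moreover have ball: "cball m \<sigma> \<subseteq> cball p (\<rho> * (1 - \<eta> ^ Suc k / 2))"
    proof
      fix z assume "z \<in> cball m \<sigma>"
      then have "dist p z \<le> dist p m + \<sigma>"
        using dist_triangle[of p z m] by simp
      also have "\<dots> \<le> \<rho> * (1 - \<eta> ^ k / 2) + \<eta> ^ k * \<rho> / 8"
        using mB \<sigma> r by (simp add: B_def s_def)
      also have "\<dots> \<le> \<rho> * (1 - \<eta> ^ Suc k / 2)"
      proof -
        have "\<eta> * (\<eta> ^ k * \<rho>) \<le> 1/4 * (\<eta> ^ k * \<rho>)"
          using \<eta> \<rho> by (intro mult_right_mono) auto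
        moreover have "0 \<le> \<eta> ^ k * \<rho>" using \<eta> \<rho> by simp
        ultimately show ?thesis by (simp add: algebra_simps)
      qed
      finally show "z \<in> cball p (\<rho> * (1 - \<eta> ^ Suc k / 2))" by simp
    qed
    moreover have "cball p (\<rho> * (1 - \<eta> ^ Suc k / 2)) \<subseteq> cball p \<rho>"
      using \<eta> \<rho> by (intro subset_cball) (simp add: mult_le_cancel_left1)
    moreover have "\<bar>u z - u m - inner a (z - m)\<bar> \<le> \<epsilon> * \<sigma>" if z: "z \<in> cball m \<sigma> \<inter> S" for z
    proof -
      define w where "w = (x - y) /\<^sub>R 2"
      have w: "norm w = r" "x = m + w" "y = m - w"
      proof -
        show "norm w = r" by (simp add: w_def r_def dist_norm)
        have "(1/2) *\<^sub>R x + (1/2) *\<^sub>R x = x" "(1/2) *\<^sub>R y + (1/2) *\<^sub>R y = y"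
          by (simp_all flip: scaleR_add_left)
        then show "x = m + w" "y = m - w"
          by (simp_all add: w_def m_def midpoint_def scaleR_add_right scaleR_diff_right)
      qed
      have a: "inner a v = \<kappa> * (inner w v / r)" for v
        using r by (simp add: a_def w_def)
      have bounds: "u x - u z' \<le> \<kappa> * (r - inner w (z' - m) / r) + \<kappa> * (\<sigma>\<^sup>2 / (2 * r))"
                   "u z' - u y \<le> \<kappa> * (r + inner w (z' - m) / r) + \<kappa> * (\<sigma>\<^sup>2 / (2 * r))"
        if z': "z' \<in> cball m \<sigma> \<inter> S" for z'
      proof -
        define v where "v = z' - m"
        have v: "norm v \<le> \<sigma>" using z' by (simp add: v_def dist_norm norm_minus_commute)
        have "(norm v)\<^sup>2 / (2 * r) \<le> \<sigma>\<^sup>2 / (2 * r)"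
          using v r by (intro divide_right_mono power_mono) auto
        then have "norm (w + - v) \<le> r - inner w v / r + \<sigma>\<^sup>2 / (2 * r)"
          "norm (w + v) \<le> r + inner w v / r + \<sigma>\<^sup>2 / (2 * r)"
          using norm_add_le_inner[OF w(1) r(1), of "- v"] norm_add_le_inner[OF w(1) r(1), of v] by auto
        moreover have "norm (w + - v) = dist x z'" "norm (w + v) = dist z' y"
          using w by (auto simp: v_def dist_norm algebra_simps)
        ultimately have le: "dist x z' \<le> r - inner w v / r + \<sigma>\<^sup>2 / (2 * r)"
          "dist z' y \<le> r + inner w v / r + \<sigma>\<^sup>2 / (2 * r)" by auto
        have far: "dist x z' \<ge> s (Suc k)" "dist z' y \<ge> s (Suc k)"
        proof -
          have "dist x m = r" "dist m y = r" using w by (auto simp: dist_norm)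
          then have "r - \<sigma> \<le> dist x z'" "r - \<sigma> \<le> dist z' y"
            using z' dist_triangle[of x m z'] dist_triangle[of m y z'] by (auto simp: dist_commute)
          moreover have "s (Suc k) \<le> 1/4 * s k"
            unfolding s_def using \<eta> \<rho> by (simp add: mult_right_mono)
          ultimately show "dist x z' \<ge> s (Suc k)" "dist z' y \<ge> s (Suc k)"
            using \<sigma> r by auto
        qed
        have in_B: "x \<in> B (Suc k)" "y \<in> B (Suc k)" "z' \<in> B (Suc k)"
          using xyB B_mono[of k "Suc k"] z' ball by (auto simp: B_def)
        have "u x - u z' \<le> \<kappa> * dist x z'" "u z' - u y \<le> \<kappa> * dist z' y"
          unfolding \<kappa>_def using in_B far by (auto intro!: slope_le_M)
        moreover have "\<kappa> * dist x z' \<le> \<kappa> * (r - inner w v / r + \<sigma>\<^sup>2 / (2 * r))"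
          "\<kappa> * dist z' y \<le> \<kappa> * (r + inner w v / r + \<sigma>\<^sup>2 / (2 * r))"
          using le \<kappa> by (auto intro: mult_left_mono)
        ultimately show "u x - u z' \<le> \<kappa> * (r - inner w (z' - m) / r) + \<kappa> * (\<sigma>\<^sup>2 / (2 * r))"
            "u z' - u y \<le> \<kappa> * (r + inner w (z' - m) / r) + \<kappa> * (\<sigma>\<^sup>2 / (2 * r))"
          by (auto simp: v_def algebra_simps)
      qed
      have m_in: "m \<in> cball m \<sigma> \<inter> S" using \<open>m \<in> S\<close> \<sigma> by simp
      have bm: "u x - u m \<le> \<kappa> * r + \<kappa> * (\<sigma>\<^sup>2 / (2 * r))" "u m - u y \<le> \<kappa> * r + \<kappa> * (\<sigma>\<^sup>2 / (2 * r))"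
        using bounds[OF m_in] by auto
      have bz: "u x - u z \<le> \<kappa> * r - inner a (z - m) + \<kappa> * (\<sigma>\<^sup>2 / (2 * r))"
        "u z - u y \<le> \<kappa> * r + inner a (z - m) + \<kappa> * (\<sigma>\<^sup>2 / (2 * r))"
        using bounds[OF z] unfolding a by (auto simp: algebra_simps)
      have uxy: "u x - u y \<ge> 2 * \<kappa> * r - 4 * \<delta> * r"
        using xy(5) by (simp add: r_def algebra_simps)
      have "\<bar>u z - u m - inner a (z - m)\<bar> \<le> 4 * \<delta> * r + 2 * (\<kappa> * (\<sigma>\<^sup>2 / (2 * r)))"
        using bm bz uxy by linarith
      also have "2 * (\<kappa> * (\<sigma>\<^sup>2 / (2 * r))) \<le> \<epsilon> * \<sigma> / 2"
      proof -
        have "\<kappa> * \<eta> \<le> \<epsilon>"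
          using \<kappa> \<eta> by (meson mult_right_mono order_less_imp_le order_trans)
        have "2 * (\<kappa> * (\<sigma>\<^sup>2 / (2 * r))) = (\<kappa> * \<eta>) * \<sigma> / 2"
          using r by (simp add: \<sigma>_def power2_eq_square field_simps)
        also have "\<dots> \<le> \<epsilon> * \<sigma> / 2"
          using \<open>\<kappa> * \<eta> \<le> \<epsilon>\<close> \<sigma> by (simp add: mult_right_mono)
        finally show ?thesis .
      qed
      also have "4 * \<delta> * r = \<epsilon> * \<sigma> / 2"
        by (simp add: \<delta>_def \<sigma>_def)
      finally show ?thesis by simp
    qed
    ultimately show ?thesis
      unfolding almost_affine_on_def by blast
  qed
  ultimately show ?thesis by blast
qed

text \<open>
  One function is treated at a time. The earlier ones stay almost affine on the smaller ball because
  they were approximated with an error that is small compared with that ball, too; this uses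
  that the loss of radius \<open>c1\<close> in the last step is known beforehand.
\<close>

lemma Lipschitz_functions_almost_affine:
  fixes S :: "'a::real_inner set"
  assumes S: "subspace S" and e: "e \<in> S" "norm e = 1" and "L \<ge> 0"
  shows "\<epsilon> > 0 \<Longrightarrow> \<exists>c>0. \<forall>p\<in>S. \<forall>\<rho>>0. \<forall>u :: nat \<Rightarrow> 'a \<Rightarrow> real.
    (\<forall>i<n. L-lipschitz_on (cball p \<rho> \<inter> S) (u i)) \<longrightarrow>
    (\<exists>m\<in>S. \<exists>\<sigma>\<ge>c * \<rho>. cball m \<sigma> \<subseteq> cball p \<rho> \<and> (\<exists>a. \<forall>i<n. almost_affine_on S \<epsilon> (u i) (a i) m \<sigma>))"
proof (induction n arbitrary: \<epsilon>)
  case 0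
  show ?case by (rule exI[of _ 1]) auto
next
  case (Suc n)
  obtain c1 where "c1 > 0" and c1: "\<forall>p\<in>S. \<forall>\<rho>>0. \<forall>u. L-lipschitz_on (cball p \<rho> \<inter> S) u \<longrightarrow>
    (\<exists>m\<in>S. \<exists>\<sigma>\<ge>c1 * \<rho>. cball m \<sigma> \<subseteq> cball p \<rho> \<and> (\<exists>a. almost_affine_on S \<epsilon> u a m \<sigma>))"
    using Lipschitz_function_almost_affine[OF S e Suc.prems \<open>L \<ge> 0\<close>] by (elim exE conjE)
  have "\<epsilon> * c1 / 2 > 0" using Suc.prems \<open>c1 > 0\<close> by simp
  from Suc.IH[OF this] obtain c2 where "c2 > 0" and c2: "\<forall>p\<in>S. \<forall>\<rho>>0. \<forall>u :: nat \<Rightarrow> 'a \<Rightarrow> real.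
    (\<forall>i<n. L-lipschitz_on (cball p \<rho> \<inter> S) (u i)) \<longrightarrow>
    (\<exists>m\<in>S. \<exists>\<sigma>\<ge>c2 * \<rho>. cball m \<sigma> \<subseteq> cball p \<rho> \<and>
      (\<exists>a. \<forall>i<n. almost_affine_on S (\<epsilon> * c1 / 2) (u i) (a i) m \<sigma>))"
    by (elim exE conjE)
  show ?case
  proof (intro exI[of _ "c1 * c2"] conjI ballI allI impI)
    show "c1 * c2 > 0" using \<open>c1 > 0\<close> \<open>c2 > 0\<close> by simp
    fix p :: 'a and \<rho> :: real and u :: "nat \<Rightarrow> 'a \<Rightarrow> real"
    assume p: "p \<in> S" and \<rho>: "\<rho> > 0" and u: "\<forall>i<Suc n. L-lipschitz_on (cball p \<rho> \<inter> S) (u i)"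
    have "\<forall>i<n. L-lipschitz_on (cball p \<rho> \<inter> S) (u i)" using u by simp
    then obtain m \<sigma> a where m: "m \<in> S" "\<sigma> \<ge> c2 * \<rho>" "cball m \<sigma> \<subseteq> cball p \<rho>"
      and a: "\<forall>i<n. almost_affine_on S (\<epsilon> * c1 / 2) (u i) (a i) m \<sigma>"
      using c2[rule_format, OF p \<rho>, of u] by blast
    have "\<sigma> > 0" using m(2) \<open>c2 > 0\<close> \<rho> by (smt (verit) mult_pos_pos)
    have "L-lipschitz_on (cball m \<sigma> \<inter> S) (u n)"
      by (rule lipschitz_on_subset[of L "cball p \<rho> \<inter> S"]) (use u m(3) in auto)
    then obtain m' \<sigma>' b where m': "m' \<in> S" "\<sigma>' \<ge> c1 * \<sigma>" "cball m' \<sigma>' \<subseteq> cball m \<sigma>"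
      and b: "almost_affine_on S \<epsilon> (u n) b m' \<sigma>'"
      using c1[rule_format, OF m(1) \<open>\<sigma> > 0\<close>] by blast
    have "\<sigma>' > 0" using m'(2) \<open>c1 > 0\<close> \<open>\<sigma> > 0\<close> by (smt (verit) mult_pos_pos)
    have "c1 * c2 * \<rho> \<le> \<sigma>'"
      using order_trans[OF mult_left_mono[OF m(2), of c1] m'(2)] \<open>c1 > 0\<close> by (simp add: mult.assoc)
    moreover have "almost_affine_on S \<epsilon> (u i) (a i) m' \<sigma>'" if "i < n" for i
      unfolding almost_affine_on_def
    proof
      fix z assume "z \<in> cball m' \<sigma>' \<inter> S"
      moreover have "m' \<in> cball m' \<sigma>' \<inter> S"
        using m' \<open>\<sigma>' > 0\<close> by simp
      ultimately have "z \<in> cball m \<sigma> \<inter> S" "m' \<in> cball m \<sigma> \<inter> S"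
        using m'(3) by blast+
      then have "\<bar>u i z - u i m - inner (a i) (z - m)\<bar> \<le> \<epsilon> * c1 / 2 * \<sigma>"
        "\<bar>u i m' - u i m - inner (a i) (m' - m)\<bar> \<le> \<epsilon> * c1 / 2 * \<sigma>"
        using a \<open>i < n\<close> unfolding almost_affine_on_def by blast+
      moreover have "inner (a i) (z - m') = inner (a i) (z - m) - inner (a i) (m' - m)"
        by (simp add: inner_diff_right)
      ultimately have "\<bar>u i z - u i m' - inner (a i) (z - m')\<bar> \<le> \<epsilon> * (c1 * \<sigma>)"
        unfolding abs_le_iff by (simp add: field_simps)
      also have "\<dots> \<le> \<epsilon> * \<sigma>'"
        using m'(2) Suc.prems by (simp add: mult_left_mono)
      finally show "\<bar>u i z - u i m' - inner (a i) (z - m')\<bar> \<le> \<epsilon> * \<sigma>'" .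
    qed
    then have "\<forall>i<Suc n. almost_affine_on S \<epsilon> (u i) ((a(n := b)) i) m' \<sigma>'"
      using b by (simp add: less_Suc_eq)
    ultimately show "\<exists>m\<in>S. \<exists>\<sigma>\<ge>c1 * c2 * \<rho>. cball m \<sigma> \<subseteq> cball p \<rho> \<and>
      (\<exists>a. \<forall>i<Suc n. almost_affine_on S \<epsilon> (u i) (a i) m \<sigma>)"
      using m m' by (meson order_trans)
  qed
qed

section \<open>Regular maps between coordinate subspaces\<close>

definition regular_on :: "nat \<Rightarrow> finseq set \<Rightarrow> (finseq \<Rightarrow> finseq) \<Rightarrow> nat \<Rightarrow> bool" where
  "regular_on d U f C \<longleftrightarrow> C \<ge> 1 \<and> (\<forall>y\<in>Rn d. \<forall>r>0. \<exists>P. finite P \<and> card P \<le> C \<and>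
     {x \<in> U. f x \<in> ball y r} \<subseteq> (\<Union>p\<in>P. ball p (real C * r)))"

lemma regular_onE:
  assumes "regular_on d U f C" "y \<in> Rn d" "r > 0"
  obtains P where "finite P" "card P \<le> C" "{x \<in> U. f x \<in> ball y r} \<subseteq> (\<Union>p\<in>P. ball p (real C * r))"
  using assms unfolding regular_on_def by blast

lemma regular_on_subset:
  assumes "regular_on d U f C" "V \<subseteq> U" shows "regular_on d V f C"
  unfolding regular_on_def
proof (intro conjI ballI allI impI)
  show "C \<ge> 1" using assms by (simp add: regular_on_def)
  fix y :: finseq and r :: real assume "y \<in> Rn d" "r > 0"
  then obtain P where "finite P" "card P \<le> C" "{x \<in> U. f x \<in> ball y r} \<subseteq> (\<Union>p\<in>P. ball p (real C * r))"
    using regular_onE[OF assms(1)] by blast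
  moreover have "{x \<in> V. f x \<in> ball y r} \<subseteq> {x \<in> U. f x \<in> ball y r}"
    using assms(2) by blast
  ultimately show "\<exists>P. finite P \<and> card P \<le> C \<and> {x \<in> V. f x \<in> ball y r} \<subseteq> (\<Union>p\<in>P. ball p (real C * r))"
    by (meson order_trans)
qed

lemma regular_on_distance_gap:
  assumes "regular_on d U f C" "y \<in> Rn d" "r > 0" "D > 2 * (real C)\<^sup>2 * r"
  obtains t where "0 < t" "t < D" "\<And>z. \<lbrakk>z \<in> U; f z \<in> ball y r\<rbrakk> \<Longrightarrow> dist x z \<noteq> t"
proof -
  obtain P where P: "finite P" "card P \<le> C" "{x \<in> U. f x \<in> ball y r} \<subseteq> (\<Union>p\<in>P. ball p (real C * r))"
    using regular_onE[OF assms(1-3)] .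
  have "real C * r > 0" using assms by (simp add: regular_on_def)
  moreover have "D > 2 * real C * (real C * r)"
    using assms by (simp add: power2_eq_square mult.assoc)
  ultimately obtain t where "0 < t" "t < D" "\<And>z. z \<in> {x \<in> U. f x \<in> ball y r} \<Longrightarrow> dist x z \<noteq> t"
    using distance_gap_of_ball_cover[OF P, of D x] by metis
  then show ?thesis using that by simp
qed

text \<open>
  The linear map whose matrix has the rows \<open>a 0, \<dots>, a (d - 1)\<close>.
\<close>

definition row_map :: "nat \<Rightarrow> (nat \<Rightarrow> finseq) \<Rightarrow> finseq \<Rightarrow> finseq" where
  "row_map d a v = (\<Sum>i<d. inner (a i) v *\<^sub>R unit_seq i)"

lemma linear_row_map: "linear (row_map d a)"
  by (rule linearI)
    (simp_all add: row_map_def inner_add_right scaleR_add_left sum.distrib scaleR_sum_right)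

lemma row_map_in_Rn [simp]: "row_map d a v \<in> Rn d"
  unfolding row_map_def by (intro subspace_sum[OF subspace_Rn]) simp

lemma coord_row_map: "i < d \<Longrightarrow> coord (row_map d a v) i = inner (a i) v"
  by (simp add: row_map_def coord_eq_inner inner_sum_right unit_seq_orthonormal if_distrib cong: if_cong)

lemma norm_le_sum_coord:
  assumes "w \<in> Rn d" shows "norm w \<le> (\<Sum>i<d. \<bar>coord w i\<bar>)"
proof -
  have "norm w = norm (\<Sum>i<d. coord w i *\<^sub>R unit_seq i)"
    by (rule arg_cong[OF Rn_expansion[OF assms]])
  also have "\<dots> \<le> (\<Sum>i<d. norm (coord w i *\<^sub>R unit_seq i))" by (rule norm_sum)
  finally show ?thesis by simp
qed

text \<open>
  An injective linear map sends a basis to an independent set of the same size, which therefore spans.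
\<close>

lemma row_map_surjective:
  assumes lower: "\<And>v. v \<in> Rn d \<Longrightarrow> norm (row_map d a v) \<ge> \<delta> * norm v" and "\<delta> > 0"
    and w: "w \<in> Rn d"
  obtains v where "v \<in> Rn d" "w = row_map d a v"
proof -
  define B where "B = unit_seq ` {..<d}"
  have inj: "inj_on unit_seq {..<d}"
  proof (rule inj_onI)
    fix i j assume "unit_seq i = unit_seq j"
    then have "inner (unit_seq i) (unit_seq j) = inner (unit_seq j) (unit_seq j)" by (rule arg_cong)
    then show "i = j" by (simp add: unit_seq_orthonormal split: if_splits)
  qed
  have B: "finite B" "card B = d"
    using card_image[OF inj] by (simp_all add: B_def)
  have "x \<in> span B" if "x \<in> Rn d" for x
    by (subst Rn_expansion[OF that], intro span_sum span_scale span_base) (simp add: B_def)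
  moreover have "span B \<subseteq> Rn d"
    by (rule span_minimal[OF _ subspace_Rn]) (auto simp: B_def)
  ultimately have span: "span B = Rn d" by blast
  have "pairwise orthogonal B"
    by (auto simp: pairwise_def B_def orthogonal_def unit_seq_orthonormal)
  moreover have "0 \<notin> B"
  proof
    assume "0 \<in> B"
    then obtain i where "unit_seq i = 0" by (auto simp: B_def)
    then show False using norm_unit_seq[of i] by simp
  qed
  ultimately have indep: "independent B"
    by (rule pairwise_orthogonal_independent)
  have inj_A: "inj_on (row_map d a) (Rn d)"
  proof (rule inj_onI)
    fix x y assume "x \<in> Rn d" "y \<in> Rn d" "row_map d a x = row_map d a y"
    then have "\<delta> * norm (x - y) \<le> 0"
      using lower[of "x - y"] by (simp add: linear_diff[OF linear_row_map])
    then show "x = y" using \<open>\<delta> > 0\<close> by (simp add: mult_le_0_iff)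
  qed
  have indep_A: "independent (row_map d a ` B)"
    using linear_independent_injective_image[OF linear_row_map indep] inj_A span by simp
  have card_A: "card (row_map d a ` B) = d"
    using B card_image[OF inj_on_subset[OF inj_A], of B] span_superset[of B] span by simp
  have "w \<in> span (row_map d a ` B)"
  proof (rule ccontr)
    assume w_notin: "w \<notin> span (row_map d a ` B)"
    then have w_notin': "w \<notin> row_map d a ` B"
      by (rule contrapos_nn) (rule span_base)
    moreover have "independent (insert w (row_map d a ` B))"
      using w_notin indep_A by (rule independent_insertI)
    moreover have "insert w (row_map d a ` B) \<subseteq> span B"
      unfolding span using w by (simp add: image_subset_iff)
    ultimately have "card (insert w (row_map d a ` B)) \<le> card B"
      using independent_span_bound[OF B(1)] by blast
    then show False
      unfolding card_insert_disjoint[OF finite_imageI[OF B(1)] w_notin'] B(2) card_A by simp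
  qed
  then have "w \<in> row_map d a ` Rn d"
    by (simp only: linear_span_image[OF linear_row_map] span)
  then show ?thesis using that by blast
qed

text \<open>
  If the linear part shrank some direction by a factor below \<open>\<delta>\<close>, then \<open>f\<close> would map a segment of length
  \<open>\<sigma>\<close> starting at \<open>m\<close> into the ball of radius \<open>2 \<delta> \<sigma>\<close> around \<open>f m\<close>. The preimage of this ball avoids
  some distance from \<open>m\<close> below \<open>\<sigma>\<close>, but the segment contains points at all these distances.
\<close>

lemma near_nonsingular_linear:
  assumes U: "openin (top_of_set (Rn d)) U" "U \<noteq> {}"
    and f: "L-lipschitz_on U f" "f ` U \<subseteq> Rn d" and reg: "regular_on d U f C"
    and \<delta>: "\<delta> = 1 / (8 * (real C)\<^sup>2)" and \<epsilon>: "0 < \<epsilon>" "\<epsilon> \<le> \<delta>"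
  obtains m \<sigma> a where "m \<in> U" "\<sigma> > 0" "cball m \<sigma> \<inter> Rn d \<subseteq> U"
    "\<And>z. z \<in> cball m \<sigma> \<inter> Rn d \<Longrightarrow> norm (f z - f m - row_map d a (z - m)) \<le> \<epsilon> * \<sigma>"
    "\<And>v. v \<in> Rn d \<Longrightarrow> norm (row_map d a v) \<ge> \<delta> * norm v"
proof -
  have "C \<ge> 1" using reg by (simp add: regular_on_def)
  then have "\<delta> > 0" using \<delta> by simp
  have "L \<ge> 0" using f(1) by (rule lipschitz_on_nonneg)
  obtain p where "p \<in> U" using U by blast
  then obtain \<rho> where \<rho>: "\<rho> > 0" "cball p \<rho> \<inter> Rn d \<subseteq> U"
    using U(1) by (auto simp: openin_contains_cball)
  have p: "p \<in> Rn d" using \<open>p \<in> U\<close> U(1) openin_imp_subset by blast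
  have "\<exists>m\<in>Rn d. \<exists>\<sigma>>0. \<exists>a. cball m \<sigma> \<subseteq> cball p \<rho> \<and>
    (\<forall>i<d. almost_affine_on (Rn d) (\<epsilon> / d) (\<lambda>x. coord (f x) i) (a i) m \<sigma>)"
  proof (cases "d = 0")
    case True
    then show ?thesis using p \<rho> by auto
  next
    case False
    then have e: "unit_seq 0 \<in> Rn d" "norm (unit_seq 0) = 1" "\<epsilon> / d > 0" using \<epsilon> by auto
    have "L-lipschitz_on (cball p \<rho> \<inter> Rn d) (\<lambda>x. coord (f x) i)" for i
    proof (rule lipschitz_onI)
      show "dist (coord (f x) i) (coord (f y) i) \<le> L * dist x y"
        if "x \<in> cball p \<rho> \<inter> Rn d" "y \<in> cball p \<rho> \<inter> Rn d" for x y
      proof -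
        have "x \<in> U" "y \<in> U" using that \<rho>(2) by blast+
        have "dist (coord (f x) i) (coord (f y) i) = \<bar>inner (unit_seq i) (f x - f y)\<bar>"
          by (simp add: dist_real_def coord_eq_inner inner_diff_right)
        also have "\<dots> \<le> norm (unit_seq i) * norm (f x - f y)"
          by (rule Cauchy_Schwarz_ineq2)
        also have "\<dots> \<le> L * dist x y"
          using lipschitz_onD[OF f(1) \<open>x \<in> U\<close> \<open>y \<in> U\<close>] by (simp add: dist_norm)
        finally show ?thesis .
      qed
    qed fact
    moreover obtain c where "c > 0" and c: "\<forall>p\<in>Rn d. \<forall>\<rho>>0. \<forall>u :: nat \<Rightarrow> finseq \<Rightarrow> real.
      (\<forall>i<d. L-lipschitz_on (cball p \<rho> \<inter> Rn d) (u i)) \<longrightarrow>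
      (\<exists>m\<in>Rn d. \<exists>\<sigma>\<ge>c * \<rho>. cball m \<sigma> \<subseteq> cball p \<rho> \<and>
        (\<exists>a. \<forall>i<d. almost_affine_on (Rn d) (\<epsilon> / d) (u i) (a i) m \<sigma>))"
      using Lipschitz_functions_almost_affine[where n = d, OF subspace_Rn e(1,2) \<open>L \<ge> 0\<close> e(3)] by (elim exE conjE)
    ultimately obtain m \<sigma> a where ms: "m \<in> Rn d" "\<sigma> \<ge> c * \<rho>" "cball m \<sigma> \<subseteq> cball p \<rho>"
      "\<forall>i<d. almost_affine_on (Rn d) (\<epsilon> / d) (\<lambda>x. coord (f x) i) (a i) m \<sigma>"
      using c[rule_format, OF p \<rho>(1), of "\<lambda>i x. coord (f x) i"] by blast
    moreover have "\<sigma> > 0"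
      using ms(2) mult_pos_pos[OF \<open>c > 0\<close> \<rho>(1)] by linarith
    ultimately show ?thesis by blast
  qed
  then obtain m \<sigma> a where m: "m \<in> Rn d" and "\<sigma> > 0" and ball: "cball m \<sigma> \<subseteq> cball p \<rho>"
    and a: "\<forall>i<d. almost_affine_on (Rn d) (\<epsilon> / d) (\<lambda>x. coord (f x) i) (a i) m \<sigma>"
    by blast
  have sub: "cball m \<sigma> \<inter> Rn d \<subseteq> U" using ball \<rho>(2) by blast
  then have "m \<in> U" using m \<open>\<sigma> > 0\<close> by auto
  have near: "norm (f z - f m - row_map d a (z - m)) \<le> \<epsilon> * \<sigma>" if z: "z \<in> cball m \<sigma> \<inter> Rn d" for z
  proof -
    have "f z \<in> Rn d" "f m \<in> Rn d" using f(2) z sub \<open>m \<in> U\<close> by blast+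
    then have "norm (f z - f m - row_map d a (z - m)) \<le>
        (\<Sum>i<d. \<bar>coord (f z - f m - row_map d a (z - m)) i\<bar>)"
      by (intro norm_le_sum_coord) simp
    also have "\<dots> \<le> (\<Sum>i<d. \<epsilon> / d * \<sigma>)"
      using a z
      by (intro sum_mono) (auto simp: almost_affine_on_def minus_finseq.rep_eq coord_row_map)
    also have "\<dots> \<le> \<epsilon> * \<sigma>"
      using \<epsilon> \<open>\<sigma> > 0\<close> by simp
    finally show ?thesis .
  qed
  have lower: "norm (row_map d a v) \<ge> \<delta> * norm v" if v: "v \<in> Rn d" for v
  proof (rule ccontr)
    assume "\<not> ?thesis"
    then have small: "norm (row_map d a v) < \<delta> * norm v" by simp
    then have "norm v > 0" by (smt (verit) \<open>\<delta> > 0\<close> norm_ge_zero zero_less_mult_iff)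
    define r where "r = 2 * \<delta> * \<sigma>"
    have "r > 0" using \<open>\<delta> > 0\<close> \<open>\<sigma> > 0\<close> by (simp add: r_def)
    moreover have "\<sigma> > 2 * (real C)\<^sup>2 * r"
      using \<open>C \<ge> 1\<close> \<open>\<sigma> > 0\<close> by (simp add: r_def \<delta>)
    moreover have "f m \<in> Rn d" using f(2) \<open>m \<in> U\<close> by blast
    ultimately obtain t where t: "0 < t" "t < \<sigma>" "\<And>z. \<lbrakk>z \<in> U; f z \<in> ball (f m) r\<rbrakk> \<Longrightarrow> dist m z \<noteq> t"
      using regular_on_distance_gap[OF reg] by metis
    define w where "w = (t / norm v) *\<^sub>R v"
    have w: "norm w = t" "w \<in> Rn d" using t \<open>norm v > 0\<close> v by (auto simp: w_def)
    have "norm (row_map d a w) = t / norm v * norm (row_map d a v)"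
      using t by (simp add: w_def linear_scale[OF linear_row_map])
    also have "\<dots> \<le> t / norm v * (\<delta> * norm v)"
      using small t by (intro mult_left_mono) auto
    also have "\<dots> = \<delta> * t" using \<open>norm v > 0\<close> by simp
    also have "\<dots> < \<delta> * \<sigma>" using t \<open>\<delta> > 0\<close> by simp
    finally have Aw: "norm (row_map d a w) < \<delta> * \<sigma>" .
    have z: "m + w \<in> cball m \<sigma> \<inter> Rn d" "dist m (m + w) = t"
      using w t m by (auto simp: dist_norm)
    have "norm (f (m + w) - f m) \<le> norm (f (m + w) - f m - row_map d a w) + norm (row_map d a w)"
      using norm_triangle_ineq[of "f (m + w) - f m - row_map d a w" "row_map d a w"] by simp
    also have "\<dots> < \<epsilon> * \<sigma> + \<delta> * \<sigma>"
      using near[OF z(1)] Aw by simp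
    also have "\<dots> \<le> r"
      using \<epsilon> \<open>\<sigma> > 0\<close> by (simp add: r_def mult_right_mono)
    finally have "f (m + w) \<in> ball (f m) r" by (simp add: dist_norm norm_minus_commute)
    then show False using t(3) z sub by blast
  qed
  show ?thesis using that \<open>m \<in> U\<close> \<open>\<sigma> > 0\<close> sub near lower by blast
qed

section \<open>Essential sets\<close>

text \<open>
  No change of \<open>f\<close> over \<open>T\<close> alone can free a point of \<open>T\<close>: a stable form of surjectivity onto
  \<open>T\<close> which plays the role of a nonzero local degree.
\<close>

definition essential :: "nat \<Rightarrow> (finseq \<Rightarrow> finseq) \<Rightarrow> finseq set \<Rightarrow> finseq set \<Rightarrow> bool" where
  "essential d f T E \<longleftrightarrow> (\<forall>h. continuous_on E h \<longrightarrow> h ` E \<subseteq> Rn d \<longrightarrow>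
     (\<forall>x\<in>E. f x \<notin> T \<longrightarrow> h x = f x) \<longrightarrow> T \<inter> Rn d \<subseteq> h ` E)"

lemma essentialD:
  assumes "essential d f T E" "continuous_on E h" "h ` E \<subseteq> Rn d"
    "\<And>x. \<lbrakk>x \<in> E; f x \<notin> T\<rbrakk> \<Longrightarrow> h x = f x"
  shows "T \<inter> Rn d \<subseteq> h ` E"
  using assms unfolding essential_def by meson

lemma essential_smaller_target:
  assumes "essential d f T E" "f ` E \<subseteq> Rn d" "T' \<inter> Rn d \<subseteq> T"
  shows "essential d f T' E"
  unfolding essential_def
proof (intro allI impI)
  fix h assume h: "continuous_on E h" "h ` E \<subseteq> Rn d" "\<forall>x\<in>E. f x \<notin> T' \<longrightarrow> h x = f x"
  have "\<forall>x\<in>E. f x \<notin> T \<longrightarrow> h x = f x" using h(3) assms(2,3) by blast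
  then have "T \<inter> Rn d \<subseteq> h ` E" using assms(1) h(1,2) unfolding essential_def by blast
  then show "T' \<inter> Rn d \<subseteq> h ` E" using assms(3) by blast
qed

lemma essential_imp_covers:
  assumes "essential d f T E" "continuous_on E f" "f ` E \<subseteq> Rn d"
  shows "T \<inter> Rn d \<subseteq> f ` E"
  using assms unfolding essential_def by blast

text \<open>
  On a ball where \<open>f\<close> is close to a nonsingular affine map, \<open>f\<close> sends the boundary far away from
  \<open>f m\<close>, so a competing map \<open>h\<close> equals \<open>f\<close> there. If \<open>h\<close> missed a value \<open>q\<close> near \<open>f m\<close>, then
  the transpose of the linear part applied to \<open>h x - q\<close> would point outwards on the boundary and vanish nowhere.
  The transpose serves in place of the inverse, as it only has to be injective and to have a positive
  inner product with \<open>x - m\<close>.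
\<close>

lemma exists_essential_ball:
  assumes U: "openin (top_of_set (Rn d)) U" "U \<noteq> {}"
    and f: "L-lipschitz_on U f" "f ` U \<subseteq> Rn d" and reg: "regular_on d U f C"
  obtains c \<tau> where "c \<in> Rn d" "\<tau> > 0" "essential d f (ball c \<tau>) U"
proof -
  define \<delta> where "\<delta> = 1 / (8 * (real C)\<^sup>2)"
  have "C \<ge> 1" using reg by (simp add: regular_on_def)
  then have \<delta>: "\<delta> > 0" using \<delta>_def by simp
  obtain m \<sigma> a where m: "m \<in> U" and \<sigma>: "\<sigma> > 0" and sub: "cball m \<sigma> \<inter> Rn d \<subseteq> U"
    and near: "\<And>z. z \<in> cball m \<sigma> \<inter> Rn d \<Longrightarrow> norm (f z - f m - row_map d a (z - m)) \<le> \<delta> / 4 * \<sigma>"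
    and lower: "\<And>v. v \<in> Rn d \<Longrightarrow> norm (row_map d a v) \<ge> \<delta> * norm v"
    using near_nonsingular_linear[OF U f reg \<delta>_def, of "\<delta> / 4"] \<delta> by auto
  define \<tau> where "\<tau> = \<delta> * \<sigma> / 2"
  have "\<tau> > 0" using \<delta> \<sigma> by (simp add: \<tau>_def)
  have mR: "m \<in> Rn d" using m U(1) openin_imp_subset by blast
  have "essential d f (ball (f m) \<tau>) U"
    unfolding essential_def
  proof (intro allI impI subsetI, rule ccontr)
    fix h q
    assume h: "continuous_on U h" "h ` U \<subseteq> Rn d" "\<forall>x\<in>U. f x \<notin> ball (f m) \<tau> \<longrightarrow> h x = f x"
      and q: "q \<in> ball (f m) \<tau> \<inter> Rn d" "q \<notin> h ` U"
    have rows: "\<exists>v\<in>Rn d. w = row_map d a v" if "w \<in> Rn d" for w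
      using row_map_surjective[OF lower \<delta> that] by metis
    \<comment> \<open>\<open>adj\<close> is the transpose of the linear part, followed by the projection onto \<open>Rn d\<close>.\<close>
    define adj where "adj w = (\<Sum>j<d. inner w (row_map d a (unit_seq j)) *\<^sub>R unit_seq j)" for w
    have adj: "inner (adj w) v = inner w (row_map d a v)" if "v \<in> Rn d" for w v
    proof -
      have "inner w (row_map d a v) = inner w (row_map d a (\<Sum>j<d. coord v j *\<^sub>R unit_seq j))"
        using Rn_expansion[OF that] by metis
      also have "\<dots> = (\<Sum>j<d. coord v j * inner w (row_map d a (unit_seq j)))"
        by (simp add: linear_sum[OF linear_row_map] linear_scale[OF linear_row_map] inner_sum_right)
      also have "\<dots> = inner (adj w) v"
        by (simp add: adj_def inner_sum_left coord_eq_inner mult.commute)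
      finally show ?thesis by simp
    qed
    define k where "k x = adj (h x - q)" for x
    have "\<exists>x\<in>cball m \<sigma> \<inter> Rn d. k x = 0"
    proof (rule outward_map_has_zero)
      show "continuous_on (cball m \<sigma> \<inter> Rn d) k"
        unfolding k_def adj_def
        by (intro continuous_intros continuous_on_subset[OF h(1) sub])
      show "k ` (cball m \<sigma> \<inter> Rn d) \<subseteq> Rn d"
        unfolding k_def adj_def by (auto intro!: subspace_sum[OF subspace_Rn])
      fix x assume x: "x \<in> Rn d" "dist m x = \<sigma>"
      define v where "v = x - m"
      have v: "v \<in> Rn d" "norm v = \<sigma>" using x mR by (auto simp: v_def dist_norm norm_minus_commute)
      have xb: "x \<in> cball m \<sigma> \<inter> Rn d" using x by simp
      define A where "A = row_map d a v"
      have A: "norm A \<ge> \<delta> * \<sigma>" using lower[OF v(1)] v by (simp add: A_def)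
      have err: "norm (f x - f m - A) \<le> \<delta> * \<sigma> / 4"
        using near[OF xb] by (simp add: A_def v_def)
      have "norm A \<le> norm (f x - f m) + norm (f x - f m - A)"
        using norm_triangle_ineq4[of "f x - f m" "f x - f m - A"] by simp
      then have "norm (f x - f m) \<ge> 3 / 4 * (\<delta> * \<sigma>)"
        using A err by linarith
      moreover have "\<delta> * \<sigma> > 0" using \<delta> \<sigma> by simp
      ultimately have "norm (f x - f m) \<ge> \<tau>"
        unfolding \<tau>_def by linarith
      then have "f x \<notin> ball (f m) \<tau>"
        by (simp add: dist_norm norm_minus_commute)
      then have hx: "h x = f x" using h(3) xb sub by blast
      define w where "w = (f x - f m - A) + (f m - q)"
      have "norm w \<le> norm (f x - f m - A) + norm (f m - q)"
        unfolding w_def by (rule norm_triangle_ineq)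
      then have "norm w < norm A"
        using err q A \<open>\<delta> * \<sigma> > 0\<close> by (simp add: dist_norm \<tau>_def)
      then have "norm w * norm A < norm A * norm A"
        using norm_ge_zero[of w] by (intro mult_strict_right_mono) linarith+
      moreover have "\<bar>inner w A\<bar> \<le> norm w * norm A"
        by (rule Cauchy_Schwarz_ineq2)
      ultimately have "0 < inner w A + inner A A"
        by (simp add: power2_norm_eq_inner[symmetric] power2_eq_square)
      also have "\<dots> = inner (h x - q) A"
        by (simp add: hx w_def inner_add_left inner_diff_left)
      also have "\<dots> = inner (k x) (x - m)"
        using adj[OF v(1)] by (simp add: k_def A_def v_def)
      finally show "0 < inner (k x) (x - m)" .
    qed (use mR \<sigma> in auto)
    then obtain x where x: "x \<in> cball m \<sigma> \<inter> Rn d" "k x = 0" by blast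
    then have "h x \<in> Rn d" using h(2) sub by blast
    then have "h x - q \<in> Rn d" using q by simp
    then obtain v where "v \<in> Rn d" "h x - q = row_map d a v" using rows by blast
    then have "inner (h x - q) (h x - q) = 0"
      using adj[of v "h x - q"] x by (simp add: k_def)
    then have "h x = q" by simp
    then show False using q x sub by blast
  qed
  moreover have "f m \<in> Rn d" using f(2) m by blast
  ultimately show ?thesis using that \<open>\<tau> > 0\<close> by blast
qed

text \<open>
  The projection along rays from \<open>p\<close> onto the sphere. A point \<open>z\<close> is moved by the larger root \<open>s z\<close> of
  the quadratic equation that puts \<open>z + s z *\<^sub>R (z - p)\<close> on the sphere; outside the ball the formula for it is not positive,
  and replacing it by \<open>0\<close> leaves such points fixed. The formula makes sense there even when the
  discriminant \<open>D z\<close> is negative, because \<open>sqrt\<close> is odd and continuous on the whole line.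
\<close>

lemma push_out_of_ball:
  fixes S :: "'a::real_inner set"
  assumes S: "subspace S" "c \<in> S" "p \<in> S" and p: "p \<in> ball c \<tau>"
  shows "\<exists>\<pi>. continuous_on (- {p}) \<pi> \<and> \<pi> ` S \<subseteq> S \<and>
    (\<forall>z. z \<notin> ball c \<tau> \<longrightarrow> \<pi> z = z) \<and> (\<forall>z. z \<noteq> p \<longrightarrow> \<pi> z \<notin> ball c \<tau>)"
proof -
  define b where "b z = inner (z - c) (z - p)" for z
  define D where "D z = (b z)\<^sup>2 + (norm (z - p))\<^sup>2 * (\<tau>\<^sup>2 - (norm (z - c))\<^sup>2)" for z
  define s where "s z = max 0 ((- b z + sqrt (D z)) / (norm (z - p))\<^sup>2)" for z
  define \<pi> where "\<pi> z = z + s z *\<^sub>R (z - p)" for z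
  have "\<tau> > 0" using p by (smt (verit) mem_ball zero_le_dist)
  have fixed: "\<pi> z = z" if "z \<notin> ball c \<tau>" for z
  proof -
    have z: "norm (z - c) \<ge> \<tau>" using that by (simp add: dist_norm norm_minus_commute)
    have "inner (z - c) (p - c) \<le> norm (z - c) * norm (p - c)" by (rule norm_cauchy_schwarz)
    also have "\<dots> \<le> norm (z - c) * norm (z - c)"
      using p z by (intro mult_left_mono) (auto simp: dist_norm norm_minus_commute)
    also have "\<dots> = inner (z - c) (z - c)"
      by (simp flip: power2_norm_eq_inner power2_eq_square)
    also have "\<dots> = b z + inner (z - c) (p - c)"
      by (simp add: b_def flip: inner_add_right)
    finally have b: "b z \<ge> 0" by simp
    moreover have "D z \<le> (b z)\<^sup>2"
      using power_mono[OF z, of 2] \<open>\<tau> > 0\<close> by (simp add: D_def mult_nonneg_nonpos)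
    ultimately have "sqrt (D z) \<le> b z"
      using real_sqrt_le_mono[of "D z" "(b z)\<^sup>2"] by simp
    then show ?thesis by (simp add: \<pi>_def s_def divide_nonpos_nonneg)
  qed
  have out: "\<pi> z \<notin> ball c \<tau>" if "z \<noteq> p" for z
  proof (cases "z \<in> ball c \<tau>")
    case False
    then show ?thesis using fixed by simp
  next
    case True
    define n2 where "n2 = (norm (z - p))\<^sup>2"
    have n2: "n2 > 0" using that by (simp add: n2_def)
    have Dz: "D z = (b z)\<^sup>2 + n2 * (\<tau>\<^sup>2 - (norm (z - c))\<^sup>2)"
      by (simp add: D_def n2_def)
    have "(norm (z - c))\<^sup>2 < \<tau>\<^sup>2"
      using True by (intro power_strict_mono) (auto simp: dist_norm norm_minus_commute)
    then have D: "D z > (b z)\<^sup>2" using n2 by (simp add: D_def n2_def)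
    then have "sqrt (D z) \<ge> b z"
      by (intro real_le_rsqrt) simp
    then have s: "n2 * s z = - b z + sqrt (D z)"
      using n2 by (simp add: s_def n2_def)
    have "D z \<ge> 0" using D by (smt (verit) zero_le_power2)
    then have "(n2 * s z + b z)\<^sup>2 = D z" using s by simp
    then have "n2 * (n2 * (s z)\<^sup>2 + 2 * s z * b z + (norm (z - c))\<^sup>2 - \<tau>\<^sup>2) = 0"
      unfolding Dz by (simp add: power2_eq_square algebra_simps)
    then have "n2 * (s z)\<^sup>2 + 2 * s z * b z + (norm (z - c))\<^sup>2 = \<tau>\<^sup>2"
      using n2 by simp
    moreover have "(norm (\<pi> z - c))\<^sup>2 = n2 * (s z)\<^sup>2 + 2 * s z * b z + (norm (z - c))\<^sup>2"
    proof -
      have "\<pi> z - c = (z - c) + s z *\<^sub>R (z - p)" by (simp add: \<pi>_def)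
      then have "(norm (\<pi> z - c))\<^sup>2 = inner ((z - c) + s z *\<^sub>R (z - p)) ((z - c) + s z *\<^sub>R (z - p))"
        by (simp only: power2_norm_eq_inner)
      also have "\<dots> = inner (z - c) (z - c) + 2 * s z * inner (z - c) (z - p)
          + (s z)\<^sup>2 * inner (z - p) (z - p)"
        unfolding inner_add_left inner_add_right inner_scaleR_left inner_scaleR_right
        by (simp add: inner_commute[of "z - p" "z - c"] power2_eq_square distrib_left)
      finally show ?thesis by (simp add: n2_def b_def power2_norm_eq_inner)
    qed
    ultimately have "norm (\<pi> z - c) = \<tau>"
      using \<open>\<tau> > 0\<close> by simp
    then show ?thesis by (simp add: dist_norm norm_minus_commute)
  qed
  have "continuous_on (- {p}) \<pi>"
    unfolding \<pi>_def s_def D_def b_def by (intro continuous_intros) auto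
  moreover have "\<pi> ` S \<subseteq> S"
    using S by (auto simp: \<pi>_def intro!: subspace_add subspace_scale subspace_diff)
  ultimately show ?thesis using fixed out by blast
qed

text \<open>
  If neither piece is essential, both carry maps that miss a point of the ball. The missed points may be
  different; pushing the values out of the ball makes both maps avoid the entire ball. They can then be glued
  with \<open>f\<close> itself, which takes values outside the closed ball on the rest of \<open>E\<close>.
\<close>

lemma essential_split:
  assumes ess: "essential d f (ball c \<tau>) E" and c: "c \<in> Rn d" "\<tau> > 0"
    and f: "continuous_on E f" "f ` E \<subseteq> Rn d"
    and E1: "openin (top_of_set E) E1" and E2: "openin (top_of_set E) E2" and disj: "E1 \<inter> E2 = {}"
    and rest: "\<And>z. \<lbrakk>z \<in> E; z \<notin> E1; z \<notin> E2\<rbrakk> \<Longrightarrow> f z \<notin> cball c \<tau>"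
  shows "essential d f (ball c \<tau>) E1 \<or> essential d f (ball c \<tau>) E2"
proof (rule ccontr)
  have sub: "E1 \<subseteq> E" "E2 \<subseteq> E" using E1 E2 openin_imp_subset by blast+
  have pushed: "\<exists>g. continuous_on F g \<and> g ` F \<subseteq> Rn d - ball c \<tau> \<and> (\<forall>z\<in>F. f z \<notin> ball c \<tau> \<longrightarrow> g z = f z)"
    if F: "\<not> essential d f (ball c \<tau>) F" for F
  proof -
    obtain h p where h: "continuous_on F h" "h ` F \<subseteq> Rn d" "\<forall>z\<in>F. f z \<notin> ball c \<tau> \<longrightarrow> h z = f z"
      and p: "p \<in> ball c \<tau> \<inter> Rn d" "p \<notin> h ` F"
      using F unfolding essential_def by blast
    obtain \<pi> where \<pi>: "continuous_on (- {p}) \<pi>" "\<pi> ` Rn d \<subseteq> Rn d"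
      "\<forall>z. z \<notin> ball c \<tau> \<longrightarrow> \<pi> z = z" "\<forall>z. z \<noteq> p \<longrightarrow> \<pi> z \<notin> ball c \<tau>"
      using push_out_of_ball[OF subspace_Rn c(1) IntD2[OF p(1)] IntD1[OF p(1)]] by blast
    have "continuous_on F (\<lambda>z. \<pi> (h z))"
      by (rule continuous_on_compose2[OF \<pi>(1) h(1)]) (use p(2) in blast)
    moreover have "\<pi> (h z) \<in> Rn d - ball c \<tau>" if "z \<in> F" for z
    proof -
      have "h z \<in> Rn d" "h z \<noteq> p" using h(2) p(2) that by auto
      then show ?thesis using \<pi>(2,4) by (simp add: image_subset_iff)
    qed
    moreover have "\<pi> (h z) = f z" if "z \<in> F" "f z \<notin> ball c \<tau>" for z
      using \<pi>(3) h(3) that by simp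
    ultimately show ?thesis
      by (intro exI[of _ "\<lambda>z. \<pi> (h z)"] conjI ballI impI image_subsetI) simp_all
  qed
  assume "\<not> ?thesis"
  then have not_ess: "\<not> essential d f (ball c \<tau>) E1" "\<not> essential d f (ball c \<tau>) E2" by blast+
  obtain g1 where g1: "continuous_on E1 g1" "g1 ` E1 \<subseteq> Rn d - ball c \<tau>" "\<forall>z\<in>E1. f z \<notin> ball c \<tau> \<longrightarrow> g1 z = f z"
    using pushed[OF not_ess(1)] by blast
  obtain g2 where g2: "continuous_on E2 g2" "g2 ` E2 \<subseteq> Rn d - ball c \<tau>" "\<forall>z\<in>E2. f z \<notin> ball c \<tau> \<longrightarrow> g2 z = f z"
    using pushed[OF not_ess(2)] by blast
  define E3 where "E3 = {z \<in> E. f z \<in> - cball c \<tau>}"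
  have E3: "openin (top_of_set E) E3"
    using continuous_openin_preimage_gen[OF f(1), of "- cball c \<tau>"]
    by (simp add: E3_def vimage_def Int_def open_Compl)
  have E_eq: "E = (E1 \<union> E2) \<union> E3" using sub rest by (auto simp: E3_def)
  define g where "g z = (if z \<in> E1 then g1 z else g2 z)" for z
  define h where "h z = (if z \<in> E1 \<union> E2 then g z else f z)" for z
  have "openin (top_of_set (E1 \<union> E2)) E1" "openin (top_of_set (E1 \<union> E2)) E2"
    using E1 E2 sub by (auto intro: openin_subset_trans)
  then have "continuous_on (E1 \<union> E2) g"
    unfolding g_def using g1(1) g2(1) disj by (intro continuous_on_cases_local_open) auto
  moreover have "continuous_on E3 f"
    using f(1) by (rule continuous_on_subset) (auto simp: E3_def)
  moreover have "openin (top_of_set E) (E1 \<union> E2)" using E1 E2 by (rule openin_Un)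
  moreover have "g z = f z" if "z \<in> E3" "z \<in> E1 \<union> E2" for z
    using that g1(3) g2(3) by (auto simp: g_def E3_def)
  ultimately have "continuous_on ((E1 \<union> E2) \<union> E3) h"
    unfolding h_def using E3 by (intro continuous_on_cases_local_open) (auto simp: E_eq[symmetric])
  then have cont_h: "continuous_on E h" by (simp only: E_eq[symmetric])
  have out: "h z \<in> Rn d - ball c \<tau>" if "z \<in> E" for z
  proof -
    have "g1 z \<in> Rn d - ball c \<tau>" if "z \<in> E1" using g1(2) that by blast
    moreover have "g2 z \<in> Rn d - ball c \<tau>" if "z \<in> E2" using g2(2) that by blast
    moreover have "f z \<in> Rn d - ball c \<tau>" if "z \<notin> E1" "z \<notin> E2"
      using rest[OF \<open>z \<in> E\<close> that] f(2) \<open>z \<in> E\<close> by (simp add: image_subset_iff)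
    ultimately show ?thesis by (simp add: h_def g_def)
  qed
  have agree: "h z = f z" if "z \<in> E" "f z \<notin> ball c \<tau>" for z
    using that g1(3) g2(3) by (simp add: h_def g_def)
  have "h ` E \<subseteq> Rn d" using out by (simp add: image_subset_iff)
  then have "ball c \<tau> \<inter> Rn d \<subseteq> h ` E"
    by (rule essentialD[OF ess cont_h _ agree])
  moreover have "c \<in> ball c \<tau> \<inter> Rn d" using c by simp
  ultimately have "c \<in> h ` E" by (rule subsetD)
  then show False using out c by force
qed

section \<open>A piece with a lower bilipschitz bound\<close>

text \<open>
  At a radius below the mutual distances of the points of a fibre, each covering ball contains at most one of
  them.
\<close>

lemma regular_on_card_fibre:
  assumes reg: "regular_on d U f C" and y: "y \<in> Rn d" and F: "finite F" "F \<subseteq> U" "f ` F \<subseteq> {y}"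
  shows "card F \<le> C"
proof -
  define D where "D = (\<lambda>q. dist (fst q) (snd q)) ` {q \<in> F \<times> F. fst q \<noteq> snd q}"
  define s where "s = Min (insert 1 D)"
  have D: "finite D" "\<And>t. t \<in> D \<Longrightarrow> t > 0"
    using F(1) by (auto simp: D_def)
  then have s: "s > 0" by (simp add: s_def)
  have s_le: "s \<le> dist u v" if "u \<in> F" "v \<in> F" "u \<noteq> v" for u v
  proof -
    have "dist u v \<in> D" using that by (force simp: D_def)
    then show ?thesis using D(1) by (simp add: s_def)
  qed
  have "C \<ge> 1" using reg by (simp add: regular_on_def)
  then obtain P where P: "finite P" "card P \<le> C"
    "{x \<in> U. f x \<in> ball y (s / (2 * C))} \<subseteq> (\<Union>p\<in>P. ball p (real C * (s / (2 * C))))"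
    using regular_onE[OF reg y, of "s / (2 * C)"] s by auto
  have "\<exists>p\<in>P. dist p u < s / 2" if "u \<in> F" for u
  proof -
    have "f u = y" "u \<in> U" using F that by auto
    then have "u \<in> {x \<in> U. f x \<in> ball y (s / (2 * C))}"
      using s \<open>C \<ge> 1\<close> by simp
    then show ?thesis using P(3) \<open>C \<ge> 1\<close> by fastforce
  qed
  then obtain g where g: "\<And>u. u \<in> F \<Longrightarrow> g u \<in> P" "\<And>u. u \<in> F \<Longrightarrow> dist (g u) u < s / 2"
    by metis
  have "inj_on g F"
  proof (rule inj_onI, rule ccontr)
    fix u v assume uv: "u \<in> F" "v \<in> F" "g u = g v" "u \<noteq> v"
    have "dist u v \<le> dist (g u) u + dist (g v) v"
      using dist_triangle3[of u v "g u"] uv(3) by simp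
    then show False using g(2)[OF uv(1)] g(2)[OF uv(2)] s_le[OF uv(1,2,4)] by simp
  qed
  then have "card F \<le> card P"
    using card_inj_on_le[of g F P] g(1) P(1) by blast
  then show ?thesis using P(2) by simp
qed

text \<open>
  The maximality argument. A pair with \<open>dist (f x) (f y) < b * D\<close>, where \<open>D = dist x y\<close>, is separated
  over the ball of radius \<open>2 * b * D\<close> around \<open>f x\<close>, because \<open>2 * C\<^sup>2 * (2 * b * D)\<close> is \<open>D / 2\<close>.
  The ball of half that radius contains both \<open>f x\<close> and \<open>f y\<close>, so each of the two parts of \<open>E\<close>
  meets its preimage.
\<close>

lemma exists_lower_bilipschitz_piece:
  assumes U: "openin (top_of_set (Rn d)) U" "U \<noteq> {}"
    and f: "L-lipschitz_on U f" "f ` U \<subseteq> Rn d" and reg: "regular_on d U f C"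
  shows "\<exists>W. openin (top_of_set (Rn d)) W \<and> W \<noteq> {} \<and> W \<subseteq> U \<and>
    (\<forall>x\<in>W. \<forall>y\<in>W. dist (f x) (f y) \<ge> 1 / (8 * (real C)\<^sup>2) * dist x y)"
proof -
  have "C \<ge> 1" using reg by (simp add: regular_on_def)
  define b where "b = 1 / (8 * (real C)\<^sup>2)"
  have b: "b > 0" using \<open>C \<ge> 1\<close> by (simp add: b_def)
  have contU: "continuous_on U f" using f(1) by (rule lipschitz_on_continuous_on)
  have cont: "continuous_on E f" if "E \<subseteq> U" for E
    using contU that by (rule continuous_on_subset)
  have into: "f ` E \<subseteq> Rn d" if "E \<subseteq> U" for E using f(2) that by blast
  have URn: "U \<subseteq> Rn d" using U(1) by (rule openin_imp_subset)
  define pieces where "pieces c \<tau> \<E> \<longleftrightarrow> finite \<E> \<and> pairwise disjnt \<E> \<and> c \<in> Rn d \<and> \<tau> > 0 \<and>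
    (\<forall>E\<in>\<E>. openin (top_of_set (Rn d)) E \<and> E \<subseteq> U \<and> essential d f (ball c \<tau>) E)" for c \<tau> \<E>
  have hit: "\<exists>x\<in>E. f x = y" if "E \<subseteq> U" "essential d f T E" "y \<in> T" "y \<in> Rn d" for E T y
    using essential_imp_covers[OF that(2) cont[OF that(1)] into[OF that(1)]] that by auto
  have card_pieces: "card \<E> < Suc C" if "pieces c \<tau> \<E>" for c \<tau> \<E>
  proof -
    have "\<exists>x\<in>E. f x = c" if "E \<in> \<E>" for E
      using \<open>pieces c \<tau> \<E>\<close> that unfolding pieces_def by (intro hit[of E "ball c \<tau>"]) auto
    then obtain g where g: "\<And>E. E \<in> \<E> \<Longrightarrow> g E \<in> E" "\<And>E. E \<in> \<E> \<Longrightarrow> f (g E) = c"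
      by metis
    have "inj_on g \<E>"
    proof (rule inj_onI, rule ccontr)
      fix E E' assume E: "E \<in> \<E>" "E' \<in> \<E>" "g E = g E'" "E \<noteq> E'"
      then have "disjnt E E'" using that by (simp add: pieces_def pairwise_def)
      then show False using g(1)[OF E(1)] g(1)[OF E(2)] E(3) by (auto simp: disjnt_def)
    qed
    then have "card \<E> = card (g ` \<E>)" by (simp add: card_image)
    also have "\<dots> \<le> C"
      using that g by (intro regular_on_card_fibre[OF reg, of c]) (auto simp: pieces_def)
    finally show ?thesis by simp
  qed
  obtain c0 \<tau>0 where "c0 \<in> Rn d" "\<tau>0 > 0" "essential d f (ball c0 \<tau>0) U"
    using exists_essential_ball[OF U f reg] .
  then have "pieces c0 \<tau>0 {U}" using U by (simp add: pieces_def)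
  then obtain \<E> where "\<exists>c \<tau>. pieces c \<tau> \<E>" and max: "\<And>\<E>' c \<tau>. pieces c \<tau> \<E>' \<Longrightarrow> card \<E>' \<le> card \<E>"
    using ex_has_greatest_nat[of "\<lambda>\<E>. \<exists>c \<tau>. pieces c \<tau> \<E>" "{U}" card "Suc C"] card_pieces by metis
  then obtain c \<tau> where pieces: "pieces c \<tau> \<E>" by blast
  have "\<E> \<noteq> {}" using max[OF \<open>pieces c0 \<tau>0 {U}\<close>] by auto
  then obtain E where E: "E \<in> \<E>" by blast
  have c: "c \<in> Rn d" "\<tau> > 0" and fin: "finite \<E>" and disj: "pairwise disjnt \<E>"
    and openE: "openin (top_of_set (Rn d)) E" and "E \<subseteq> U" and essE: "essential d f (ball c \<tau>) E"
    using pieces E by (auto simp: pieces_def)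
  note cE = cont[OF \<open>E \<subseteq> U\<close>] and iE = into[OF \<open>E \<subseteq> U\<close>]
  have preimage_open: "openin (top_of_set (Rn d)) {z \<in> G. f z \<in> T}"
    if "openin (top_of_set (Rn d)) G" "G \<subseteq> U" "open T" for G T
    using openin_trans[OF continuous_openin_preimage_gen[OF cont[OF that(2)] that(3)] that(1)]
    by (simp add: vimage_def Int_def)
  \<comment> \<open>A maximal family cannot contain a set with two disjoint open parts, one essential and the other
    merely nonempty, over a smaller ball.\<close>
  have no_room: False
    if F: "openin (top_of_set (Rn d)) F" "F \<subseteq> E" and G: "openin (top_of_set (Rn d)) G" "G \<subseteq> E"
      and FG: "F \<inter> G = {}" and T: "open T" "T \<subseteq> ball c \<tau>" "essential d f T F" and w: "w \<in> G" "f w \<in> T"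
    for F G T w
  proof -
    define V where "V = {z \<in> G. f z \<in> T}"
    have V: "openin (top_of_set (Rn d)) V" "V \<noteq> {}" "V \<subseteq> U"
      using preimage_open[OF G(1) _ T(1)] G(2) \<open>E \<subseteq> U\<close> w by (auto simp: V_def)
    obtain c' \<tau>' where c': "c' \<in> Rn d" "\<tau>' > 0" and essV: "essential d f (ball c' \<tau>') V"
      using exists_essential_ball[OF V(1,2) lipschitz_on_subset[OF f(1) V(3)] into[OF V(3)]
          regular_on_subset[OF reg V(3)]] .
    have small: "ball c' \<tau>' \<inter> Rn d \<subseteq> T"
      using essential_imp_covers[OF essV cont[OF V(3)] into[OF V(3)]] by (auto simp: V_def)
    have "F \<subseteq> U" using F(2) \<open>E \<subseteq> U\<close> by blast
    have bigger: "pieces c' \<tau>' (insert V (insert F (\<E> - {E})))"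
      unfolding pieces_def
    proof (intro conjI ballI)
      have *: "disjnt E E'" if "E' \<in> \<E> - {E}" for E'
        using disj E that by (auto simp: pairwise_def)
      have "V \<subseteq> E" "disjnt V F" "disjnt F V" using G(2) FG by (auto simp: V_def disjnt_def)
      moreover have "disjnt V E'" "disjnt E' V" "disjnt F E'" "disjnt E' F" if "E' \<in> \<E> - {E}" for E'
        using *[OF that] \<open>V \<subseteq> E\<close> F(2) by (auto simp: disjnt_def)
      moreover have "pairwise disjnt (\<E> - {E})"
        using disj by (rule pairwise_subset) blast
      ultimately show "pairwise disjnt (insert V (insert F (\<E> - {E})))"
        by (auto simp: pairwise_insert)
      fix E' assume E': "E' \<in> insert V (insert F (\<E> - {E}))"
      then show op: "openin (top_of_set (Rn d)) E'" and sub: "E' \<subseteq> U"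
        using V F(1) \<open>F \<subseteq> U\<close> pieces by (auto simp: pieces_def)
      have iE': "f ` E' \<subseteq> Rn d" using sub by (rule into)
      consider "E' = V" | "E' = F" | "E' \<in> \<E>" using E' by blast
      then show "essential d f (ball c' \<tau>') E'"
      proof cases
        case 1
        then show ?thesis using essV by simp
      next
        case 2
        then show ?thesis using essential_smaller_target[OF T(3) _ small] iE' by simp
      next
        case 3
        then have "essential d f (ball c \<tau>) E'" using pieces by (simp add: pieces_def)
        then show ?thesis by (rule essential_smaller_target[OF _ iE' order_trans[OF small T(2)]])
      qed
    qed (use fin c' in auto)
    have "card (insert V (insert F (\<E> - {E}))) = Suc (card \<E>)"
    proof -
      have c'_mem: "c' \<in> ball c' \<tau>'" "c' \<in> T" using c' small by auto
      have ne: "F \<noteq> {}" using hit[OF \<open>F \<subseteq> U\<close> T(3) c'_mem(2) c'(1)] by blast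
      have "E' \<inter> E = {}" if "E' \<in> \<E> - {E}" for E'
        using disj E that by (auto simp: pairwise_def disjnt_def)
      then have "F \<notin> \<E> - {E}" "V \<notin> insert F (\<E> - {E})"
        using ne V(2) F(2) G(2) FG by (auto simp: V_def)
      then have "card (insert V (insert F (\<E> - {E}))) = Suc (Suc (card (\<E> - {E})))"
        using fin by simp
      also have "\<dots> = Suc (card \<E>)" using fin E by (simp only: card.remove)
      finally show ?thesis .
    qed
    then show False using max[OF bigger] by simp
  qed
  obtain x0 where x0: "x0 \<in> E" "f x0 = c"
    using hit[OF \<open>E \<subseteq> U\<close> essE _ c(1)] c(2) by auto
  \<comment> \<open>Both restrictions keep the ball of radius \<open>b * dist x y\<close> around \<open>f x\<close> inside \<open>ball c \<tau>\<close>.\<close>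
  define W where "W = {z \<in> E. f z \<in> ball c (\<tau> / 2)} \<inter> (Rn d \<inter> ball x0 (\<tau> / (4 * b)))"
  have "openin (top_of_set (Rn d)) W"
    unfolding W_def by (intro openin_Int preimage_open openE \<open>E \<subseteq> U\<close> openin_open_Int open_ball)
  moreover have "x0 \<in> W" using x0 c b \<open>E \<subseteq> U\<close> URn by (auto simp: W_def)
  moreover have "W \<subseteq> U" using \<open>E \<subseteq> U\<close> by (auto simp: W_def)
  moreover have "dist (f x) (f y) \<ge> b * dist x y" if x: "x \<in> W" and y: "y \<in> W" for x y
  proof (rule ccontr)
    assume "\<not> ?thesis"
    then have close: "dist (f x) (f y) < b * dist x y" by simp
    define D where "D = dist x y"
    have "D > 0" using close b by (auto simp: D_def)
    have "D < \<tau> / (2 * b)"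
      using x y dist_triangle[of x y x0] by (auto simp: W_def D_def dist_commute)
    then have "b * D < \<tau> / 2" using b by (simp add: field_simps)
    define T where "T = ball (f x) (b * D)"
    have T: "open T" "T \<subseteq> ball c \<tau>"
    proof -
      show "T \<subseteq> ball c \<tau>"
      proof
        fix z assume "z \<in> T"
        then show "z \<in> ball c \<tau>"
          using x \<open>b * D < \<tau> / 2\<close> dist_triangle[of c z "f x"] by (auto simp: W_def T_def)
      qed
    qed (simp add: T_def)
    have xE: "x \<in> E" and yE: "y \<in> E" using x y by (auto simp: W_def)
    then have fx: "f x \<in> Rn d" using iE by blast
    have "2 * b * D > 0" using b \<open>D > 0\<close> by simp
    moreover have "D > 2 * (real C)\<^sup>2 * (2 * b * D)"
      using \<open>C \<ge> 1\<close> \<open>D > 0\<close> by (simp add: b_def)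
    ultimately obtain t where t: "0 < t" "t < D" "\<And>z. \<lbrakk>z \<in> U; f z \<in> ball (f x) (2 * b * D)\<rbrakk> \<Longrightarrow> dist x z \<noteq> t"
      using regular_on_distance_gap[OF reg fx, of "2 * b * D" D x] by metis
    define E1 where "E1 = E \<inter> ball x t"
    define E2 where "E2 = E \<inter> - cball x t"
    have open12: "openin (top_of_set E) E1" "openin (top_of_set E) E2"
      unfolding E1_def E2_def by (auto intro!: openin_open_Int)
    then have open12': "openin (top_of_set (Rn d)) E1" "openin (top_of_set (Rn d)) E2"
      using openE openin_trans by blast+
    have disj12: "E1 \<inter> E2 = {}" by (auto simp: E1_def E2_def)
    have rest: "f z \<notin> cball (f x) (b * D)" if "z \<in> E" "z \<notin> E1" "z \<notin> E2" for z
    proof -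
      have "dist x z = t" using that by (auto simp: E1_def E2_def)
      then have "f z \<notin> ball (f x) (2 * b * D)" using t(3) that(1) \<open>E \<subseteq> U\<close> by blast
      then show ?thesis
        using mult_pos_pos[OF b \<open>D > 0\<close>] unfolding mem_ball mem_cball by linarith
    qed
    have "T \<inter> Rn d \<subseteq> ball c \<tau>" using T(2) by blast
    then have "essential d f T E" by (rule essential_smaller_target[OF essE iE])
    then have ess12: "essential d f T E1 \<or> essential d f T E2"
      unfolding T_def using fx b \<open>D > 0\<close>
      by (intro essential_split[OF _ fx _ cE iE open12 disj12 rest]) auto
    have xy: "x \<in> E1" "y \<in> E2" using t xE yE by (auto simp: E1_def E2_def D_def)
    have fxy: "f x \<in> T" "f y \<in> T" using close b \<open>D > 0\<close> by (auto simp: T_def D_def)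
    have sub12: "E1 \<subseteq> E" "E2 \<subseteq> E" "E2 \<inter> E1 = {}" by (auto simp: E1_def E2_def)
    from ess12 show False
    proof
      assume "essential d f T E1"
      from no_room[OF open12'(1) sub12(1) open12'(2) sub12(2) disj12 T this xy(2) fxy(2)]
      show False .
    next
      assume "essential d f T E2"
      from no_room[OF open12'(2) sub12(2) open12'(1) sub12(1) sub12(3) T this xy(1) fxy(1)]
      show False .
    qed
  qed
  ultimately show ?thesis
    by (intro exI[of _ W]) (auto simp: b_def)
qed

section \<open>Transfer to Euclidean space and exhaustion of the domain\<close>

lemma Euclidean_space_top_of_set: "Euclidean_space d = top_of_set (topspace (Euclidean_space d))"
  by (metis Euclidean_space_def euclidean_product_topology topspace_Euclidean_space)

lemma openin_Finseq_image:
  assumes "openin (Euclidean_space d) V"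
  shows "openin (top_of_set (Rn d)) (Finseq ` V)"
proof -
  have V: "V \<subseteq> topspace (Euclidean_space d)" using assms by (rule openin_subset)
  have "openin (top_of_set (topspace (Euclidean_space d))) V"
    using assms Euclidean_space_top_of_set by metis
  then have "openin (top_of_set (Rn d)) (Rn d \<inter> coord -` V)"
    by (intro continuous_openin_preimage[OF continuous_on_coord_fun[OF continuous_on_id]])
      (auto simp: coord_in_Euclidean_space)
  also have "Rn d \<inter> coord -` V = Finseq ` V"
  proof
    show "Rn d \<inter> coord -` V \<subseteq> Finseq ` V" by (auto simp: image_iff) (metis coord_inverse)
    show "Finseq ` V \<subseteq> Rn d \<inter> coord -` V"
    proof (intro image_subsetI)
      fix x assume "x \<in> V"
      then have "x \<in> topspace (Euclidean_space d)" using V by blast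
      then show "Finseq x \<in> Rn d \<inter> coord -` V"
        using \<open>x \<in> V\<close> by (simp add: Finseq_in_Rn)
    qed
  qed
  finally show ?thesis .
qed

lemma openin_Finseq_preimage:
  assumes "openin (top_of_set (Rn d)) W"
  shows "openin (Euclidean_space d) {x \<in> topspace (Euclidean_space d). Finseq x \<in> W}"
proof -
  have "openin (top_of_set (topspace (Euclidean_space d))) (topspace (Euclidean_space d) \<inter> Finseq -` W)"
    by (rule continuous_openin_preimage[OF continuous_on_Finseq _ assms]) (auto simp: Finseq_in_Rn)
  then show ?thesis
    by (subst Euclidean_space_top_of_set) (simp add: vimage_def Int_def)
qed

lemma regular_on_Finseq:
  assumes reg: "regularity_constant (submetric (Euclidean_metric d) S) (Euclidean_metric d) f C"
    and V: "V \<subseteq> S" "V \<subseteq> topspace (Euclidean_space d)"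
    and f: "f ` V \<subseteq> topspace (Euclidean_space d)"
  shows "regular_on d (Finseq ` V) (\<lambda>z. Finseq (f (coord z))) C"
  unfolding regular_on_def
proof (intro conjI ballI allI impI)
  let ?E = "topspace (Euclidean_space d)"
  show "C \<ge> 1" using reg by (simp add: regularity_constant_def)
  fix y r assume y: "y \<in> Rn d" and r: "(0::real) < r"
  have cy: "coord y \<in> ?E" using y by (rule coord_in_Euclidean_space)
  obtain P where P: "P \<subseteq> S \<inter> ?E" "finite P" "card P \<le> C"
    and cover: "{x \<in> S \<inter> ?E. f x \<in> mball_of (Euclidean_metric d) (coord y) r}
      \<subseteq> (\<Union>p\<in>P. mball_of (submetric (Euclidean_metric d) S) p (real C * r))"
    using reg r cy unfolding regularity_constant_def mspace_submetric mspace_Euclidean_metric by blast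
  have "{x \<in> Finseq ` V. Finseq (f (coord x)) \<in> ball y r} \<subseteq> (\<Union>p\<in>Finseq ` P. ball p (real C * r))"
  proof clarify
    fix x assume x: "x \<in> V" "Finseq (f (coord (Finseq x))) \<in> ball y r"
    have xE: "x \<in> ?E" "f x \<in> ?E" using x V f by auto
    have "dist (Finseq (coord y)) (Finseq (f x)) < r"
      using x(2) xE by (simp add: coord_inverse)
    then have "f x \<in> mball_of (Euclidean_metric d) (coord y) r"
      using xE cy by (simp add: dist_Finseq[OF cy xE(2)])
    then obtain p where p: "p \<in> P" "x \<in> mball_of (submetric (Euclidean_metric d) S) p (real C * r)"
      using cover x(1) V xE by blast
    then have "p \<in> ?E" "Euclidean_dist d p x < real C * r" by auto
    then have "Finseq x \<in> ball (Finseq p) (real C * r)"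
      by (simp add: dist_Finseq[OF _ xE(1)])
    then show "Finseq x \<in> (\<Union>p\<in>Finseq ` P. ball p (real C * r))"
      using p(1) by blast
  qed
  moreover have "finite (Finseq ` P)" "card (Finseq ` P) \<le> C"
    using P card_image_le[OF P(2), of Finseq] by auto
  ultimately show "\<exists>P. finite P \<and> card P \<le> C \<and>
    {x \<in> Finseq ` V. Finseq (f (coord x)) \<in> ball y r} \<subseteq> (\<Union>p\<in>P. ball p (real C * r))"
    by blast
qed

lemma Lipschitz_regular_exists_bilipschitz_piece:
  assumes Lip: "Lipschitz_continuous_map (submetric (Euclidean_metric d) S) (Euclidean_metric d) f"
    and reg: "regularity_constant (submetric (Euclidean_metric d) S) (Euclidean_metric d) f C"
    and V: "openin (Euclidean_space d) V" "V \<subseteq> S" "V \<noteq> {}"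
  shows "\<exists>W. openin (Euclidean_space d) W \<and> W \<subseteq> V \<and> W \<noteq> {} \<and>
    (\<forall>x\<in>W. \<forall>y\<in>W. Euclidean_dist d (f x) (f y) \<ge> 1 / (8 * (real C)\<^sup>2) * Euclidean_dist d x y)"
proof -
  let ?E = "topspace (Euclidean_space d)"
  have VE: "V \<subseteq> ?E" using V(1) by (rule openin_subset)
  obtain L where fE: "f \<in> S \<inter> ?E \<rightarrow> ?E" and "L > 0"
    and L: "\<forall>x\<in>S \<inter> ?E. \<forall>y\<in>S \<inter> ?E. Euclidean_dist d (f x) (f y) \<le> L * Euclidean_dist d x y"
    using Lip unfolding Lipschitz_continuous_map_pos by auto
  define F where "F z = Finseq (f (coord z))" for z
  have in_E: "x \<in> ?E" "f x \<in> ?E" if "x \<in> V" for x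
    using that VE V(2) fE by auto
  have F_Finseq: "F (Finseq x) = Finseq (f x)" if "x \<in> V" for x
    using coord_Finseq[OF in_E(1)[OF that]] by (simp add: F_def)
  have F_Lip: "L-lipschitz_on (Finseq ` V) F"
  proof (rule lipschitz_onI)
    fix u v assume "u \<in> Finseq ` V" "v \<in> Finseq ` V"
    then obtain x y where xy: "x \<in> V" "y \<in> V" "u = Finseq x" "v = Finseq y" by blast
    have "x \<in> S \<inter> ?E" "y \<in> S \<inter> ?E" using xy in_E V(2) by auto
    then have "Euclidean_dist d (f x) (f y) \<le> L * Euclidean_dist d x y"
      using L by simp
    then show "dist (F u) (F v) \<le> L * dist u v"
      using in_E[OF xy(1)] in_E[OF xy(2)] xy by (simp add: F_Finseq dist_Finseq)
  qed (use \<open>L > 0\<close> in simp)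
  have F_Rn: "F ` Finseq ` V \<subseteq> Rn d"
    using in_E by (auto simp: F_Finseq Finseq_in_Rn)
  have F_reg: "regular_on d (Finseq ` V) F C"
    unfolding F_def by (rule regular_on_Finseq[OF reg V(2) VE]) (use in_E(2) in blast)
  have ne: "Finseq ` V \<noteq> {}" using V(3) by simp
  obtain W where W: "openin (top_of_set (Rn d)) W" "W \<noteq> {}" "W \<subseteq> Finseq ` V"
    and lower: "\<forall>x\<in>W. \<forall>y\<in>W. dist (F x) (F y) \<ge> 1 / (8 * (real C)\<^sup>2) * dist x y"
    using exists_lower_bilipschitz_piece[OF openin_Finseq_image[OF V(1)] ne F_Lip F_Rn F_reg] by (elim exE conjE)
  define W' where "W' = {x \<in> ?E. Finseq x \<in> W}"
  have W'V: "W' \<subseteq> V"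
  proof
    fix x assume "x \<in> W'"
    then have x: "x \<in> ?E" "Finseq x \<in> W" by (auto simp: W'_def)
    then obtain v where v: "v \<in> V" "Finseq x = Finseq v" using W(3) by blast
    have "x = coord (Finseq v)"
      unfolding v(2)[symmetric] by (rule coord_Finseq[OF x(1), symmetric])
    also have "\<dots> = v" by (rule coord_Finseq[OF in_E(1)[OF v(1)]])
    finally show "x \<in> V" using v(1) by simp
  qed
  show ?thesis
  proof (intro exI[of _ W'] conjI ballI)
    show "openin (Euclidean_space d) W'"
      unfolding W'_def using W(1) by (rule openin_Finseq_preimage)
    obtain w where "w \<in> W" using W(2) by blast
    then obtain v where "v \<in> V" "Finseq v \<in> W" using W(3) by blast
    then show "W' \<noteq> {}" using in_E by (auto simp: W'_def)
    fix x y assume xy: "x \<in> W'" "y \<in> W'"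
    then have xyV: "x \<in> V" "y \<in> V" and "Finseq x \<in> W" "Finseq y \<in> W" using W'V by (auto simp: W'_def)
    then have "dist (F (Finseq x)) (F (Finseq y)) \<ge> 1 / (8 * (real C)\<^sup>2) * dist (Finseq x) (Finseq y)"
      using lower by blast
    then show "Euclidean_dist d (f x) (f y) \<ge> 1 / (8 * (real C)\<^sup>2) * Euclidean_dist d x y"
      using in_E[OF xyV(1)] in_E[OF xyV(2)] by (simp add: F_Finseq[OF xyV(1)] F_Finseq[OF xyV(2)] dist_Finseq)
  qed fact
qed

text \<open>
  Removing from \<open>W n\<close> the closure of its predecessors, instead of the predecessors, keeps the
  sets open; the points lost in addition lie in the boundary of an open set, which is nowhere dense.
\<close>

lemma dense_disjoint_open_refinement:
  fixes W :: "nat \<Rightarrow> 'a set"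
  assumes W: "\<And>n. openin X (W n)"
  obtains A where "\<And>n. openin X (A n)" "\<And>n. A n \<subseteq> W n" "disjoint_family A"
    "\<And>n. W n \<subseteq> X closure_of (\<Union>n. A n)"
proof -
  define A where "A n = W n - X closure_of (\<Union>k<n. W k)" for n
  have "openin X (A n)" for n
    unfolding A_def using W by (intro openin_diff closedin_closure_of)
  moreover have "A n \<subseteq> W n" for n by (auto simp: A_def)
  moreover have "disjoint_family A"
  proof -
    have "A m \<inter> A n = {}" if "m < n" for m n
    proof -
      have "(\<Union>k<n. W k) \<subseteq> topspace X" using W openin_subset by blast
      then have "(\<Union>k<n. W k) \<subseteq> X closure_of (\<Union>k<n. W k)" by (rule closure_of_subset)
      moreover have "A m \<subseteq> (\<Union>k<n. W k)" using that by (auto simp: A_def)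
      ultimately show ?thesis unfolding A_def[of n] by blast
    qed
    then show ?thesis
      unfolding disjoint_family_on_def by (metis Int_commute linorder_neqE_nat)
  qed
  moreover have "W n \<subseteq> X closure_of (\<Union>n. A n)" for n
  proof (induction n rule: less_induct)
    case (less n)
    have "(\<Union>k<n. W k) \<subseteq> X closure_of (\<Union>n. A n)" using less by blast
    then have "X closure_of (\<Union>k<n. W k) \<subseteq> X closure_of (\<Union>n. A n)"
      by (intro closure_of_minimal closedin_closure_of)
    moreover have "(\<Union>n. A n) \<subseteq> X closure_of (\<Union>n. A n)"
      using W openin_subset by (intro closure_of_subset) (force simp: A_def)
    ultimately show ?case by (auto simp: A_def)
  qed
  ultimately show ?thesis by (rule that)
qed

theorem theorem2p10:
  shows "\<exists>b :: nat \<Rightarrow> real. (\<forall>C. b C > 0) \<and>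
    (\<forall>(d :: nat) (U :: (nat \<Rightarrow> real) set) (f :: (nat \<Rightarrow> real) \<Rightarrow> (nat \<Rightarrow> real)).
      let cl_U = Euclidean_space d closure_of U;
          dom = submetric (Euclidean_metric d) cl_U
      in
      openin (Euclidean_space d) U \<longrightarrow>
      Lipschitz_regular dom (Euclidean_metric d) f \<longrightarrow>
      (\<exists>A :: nat \<Rightarrow> (nat \<Rightarrow> real) set.
         disjoint_family A \<and>
         (\<forall>n. openin (Euclidean_space d) (A n) \<and> A n \<subseteq> cl_U) \<and>
         cl_U \<subseteq> Euclidean_space d closure_of (\<Union>n. A n) \<and>
         (\<forall>n. bilipschitz_with_lower_constant
                (submetric (Euclidean_metric d) (A n)) (Euclidean_metric d)
                (b (Reg dom (Euclidean_metric d) f)) f)))"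
proof -
  \<comment> \<open>The summand \<open>1\<close> makes the bound positive at \<open>C = 0\<close> as well.\<close>
  define b :: "nat \<Rightarrow> real" where "b C = 1 / (8 * (real C)\<^sup>2 + 1)" for C
  have b_pos: "b C > 0" for C
    by (simp add: b_def add_nonneg_pos)
  have main: "\<exists>A :: nat \<Rightarrow> (nat \<Rightarrow> real) set.
      disjoint_family A \<and>
      (\<forall>n. openin (Euclidean_space d) (A n) \<and> A n \<subseteq> Euclidean_space d closure_of U) \<and>
      Euclidean_space d closure_of U \<subseteq> Euclidean_space d closure_of (\<Union>n. A n) \<and>
      (\<forall>n. bilipschitz_with_lower_constant
             (submetric (Euclidean_metric d) (A n)) (Euclidean_metric d)
             (b (Reg (submetric (Euclidean_metric d) (Euclidean_space d closure_of U)) (Euclidean_metric d) f)) f)"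
    if U: "openin (Euclidean_space d) U"
      and f: "Lipschitz_regular (submetric (Euclidean_metric d) (Euclidean_space d closure_of U)) (Euclidean_metric d) f"
    for d :: nat and U :: "(nat \<Rightarrow> real) set" and f :: "(nat \<Rightarrow> real) \<Rightarrow> (nat \<Rightarrow> real)"
  proof -
    let ?X = "Euclidean_space d" and ?M = "Euclidean_metric d"
    let ?cl = "?X closure_of U"
    define C where "C = Reg (submetric ?M ?cl) ?M f"
    have Lip: "Lipschitz_continuous_map (submetric ?M ?cl) ?M f"
      and reg: "regularity_constant (submetric ?M ?cl) ?M f C"
      using f LeastI_ex[of "regularity_constant (submetric ?M ?cl) ?M f"]
      by (auto simp: Lipschitz_regular_def C_def Reg_def)
    have "C \<ge> 1" using reg by (simp add: regularity_constant_def)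
    then have b_le: "b C \<le> 1 / (8 * (real C)\<^sup>2)"
        unfolding b_def by (intro frac_le) auto
    have U_cl: "U \<subseteq> ?cl" using openin_subset[OF U] by (rule closure_of_subset)
    obtain \<B> :: "(nat \<Rightarrow> real) set set" where \<B>: "countable \<B>" "topological_basis \<B>"
      using ex_countable_basis by blast
    define V where "V n = from_nat_into \<B> n \<inter> U" for n
    have "\<B> \<noteq> {}"
      using topological_basisE[OF \<B>(2) open_UNIV UNIV_I] by blast
    have open_V: "openin ?X (V n)" for n
    proof -
      have "open (from_nat_into \<B> n)"
        using topological_basis_open[OF \<B>(2)] from_nat_into[OF \<open>\<B> \<noteq> {}\<close>] by blast
      then have "openin ?X (topspace ?X \<inter> from_nat_into \<B> n)"
        by (subst Euclidean_space_top_of_set) (rule openin_open_Int)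
      then have "openin ?X (topspace ?X \<inter> from_nat_into \<B> n \<inter> U)"
        using U by (rule openin_Int)
      also have "topspace ?X \<inter> from_nat_into \<B> n \<inter> U = V n"
        using openin_subset[OF U] by (auto simp: V_def)
      finally show ?thesis .
    qed
    have "\<exists>W. openin ?X W \<and> W \<subseteq> V n \<and> (V n \<noteq> {} \<longrightarrow> W \<noteq> {}) \<and>
      (\<forall>x\<in>W. \<forall>y\<in>W. Euclidean_dist d (f x) (f y) \<ge> 1 / (8 * (real C)\<^sup>2) * Euclidean_dist d x y)" for n
    proof (cases "V n = {}")
      case True
      then show ?thesis by (intro exI[of _ "{}"]) simp
    next
      case False
      have "V n \<subseteq> ?cl" using U_cl by (auto simp: V_def)
      from Lipschitz_regular_exists_bilipschitz_piece[OF Lip reg open_V this False]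
      show ?thesis by blast
    qed
    then obtain W where W: "\<And>n. openin ?X (W n)" "\<And>n. W n \<subseteq> V n" "\<And>n. V n \<noteq> {} \<Longrightarrow> W n \<noteq> {}"
      and lower: "\<And>n x y. \<lbrakk>x \<in> W n; y \<in> W n\<rbrakk> \<Longrightarrow>
        Euclidean_dist d (f x) (f y) \<ge> 1 / (8 * (real C)\<^sup>2) * Euclidean_dist d x y"
      by metis
    obtain A where A: "\<And>n. openin ?X (A n)" "\<And>n. A n \<subseteq> W n" "disjoint_family A"
      "\<And>n. W n \<subseteq> ?X closure_of (\<Union>n. A n)"
      using dense_disjoint_open_refinement[of ?X W] W(1) by metis
    have A_cl: "A n \<subseteq> ?cl" for n
      using A(2)[of n] W(2)[of n] U_cl by (auto simp: V_def)
    have "U \<subseteq> ?X closure_of (\<Union>n. A n)"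
    proof
      fix x assume x: "x \<in> U"
      show "x \<in> ?X closure_of (\<Union>n. A n)"
        unfolding in_closure_of
      proof (intro conjI allI impI)
        show "x \<in> topspace ?X" using x openin_subset[OF U] by blast
        fix T assume T: "x \<in> T \<and> openin ?X T"
        then have "openin (top_of_set (topspace ?X)) T" using Euclidean_space_top_of_set by metis
        then obtain G where G: "open G" "T = topspace ?X \<inter> G"
          by (auto simp: openin_open)
        then obtain B where B: "B \<in> \<B>" "x \<in> B" "B \<subseteq> G"
          using topological_basisE[OF \<B>(2) G(1), of x] T by blast
        then obtain n where n: "from_nat_into \<B> n = B"
          using from_nat_into_surj[OF \<B>(1)] by blast
        have "V n \<noteq> {}" using n B x by (auto simp: V_def)
        then obtain w where w: "w \<in> W n" using W(3) by blast
        then have "w \<in> ?X closure_of (\<Union>n. A n)" using A(4) by blast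
        then obtain z where "z \<in> (\<Union>n. A n)" "z \<in> W n"
          using w W(1)[of n] unfolding in_closure_of by blast
        moreover have "W n \<subseteq> T"
          using W(2)[of n] n B(3) openin_subset[OF U] by (auto simp: V_def G(2))
        ultimately show "\<exists>y. y \<in> (\<Union>n. A n) \<and> y \<in> T" by blast
      qed
    qed
    then have "?cl \<subseteq> ?X closure_of (\<Union>n. A n)"
      by (intro closure_of_minimal closedin_closure_of)
    moreover have "bilipschitz_with_lower_constant (submetric ?M (A n)) ?M (b C) f" for n
      unfolding bilipschitz_with_lower_constant_def
    proof (intro conjI ballI)
      show "Lipschitz_continuous_map (submetric ?M (A n)) ?M f"
        by (rule Lipschitz_continuous_map_from_submetric_mono[OF Lip A_cl])
      fix x y assume "x \<in> mspace (submetric ?M (A n))" "y \<in> mspace (submetric ?M (A n))"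
      then have "x \<in> W n" "y \<in> W n" using A(2) by auto
      moreover have "b C * Euclidean_dist d x y \<le> 1 / (8 * (real C)\<^sup>2) * Euclidean_dist d x y"
        by (rule mult_right_mono[OF b_le]) (simp add: Euclidean_dist_def)
      ultimately show "b C * mdist (submetric ?M (A n)) x y \<le> mdist ?M (f x) (f y)"
        using lower[of x n y] by simp
    qed (rule b_pos)
    ultimately show ?thesis
      using A(1,3) A_cl unfolding C_def by blast
  qed
  show ?thesis
    unfolding Let_def using b_pos main by (intro exI[of _ b]) blast
qed

end
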